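(* Let $(E,\omega)$ be an LV-graph and $R$ a domain. Then the Jacobson radical of $L_R(E,\omega)$ is zero.
   Context: A weighted graph $(E,\omega)$, $E=(E^0,E^{\mathrm{st}},E^1,s,r,\omega)$, consists of countable sets $E^0$ (vertices), $E^{\mathrm{st}}$ (structured edges), $E^1$ (edges), maps $s,r:E^{\mathrm{st}}\to E^0$ and a weight map $\omega:E^{\mathrm{st}}\to\mathbb N=\{1,2,\dots\}$ such that $E^1=\bigsqcup_{\alpha\in E^{\mathrm{st}}}\{\alpha_1,\dots,\alpha_{\omega(\alpha)}\}$. All weighted graphs are assumed row-finite: $s^{-1}(v)\subseteq E^{\mathrm{st}}$ is finite for every $v\in E^0$. A vertex $v$ is a sink if $s^{-1}(v)=\emptyset$; if $v$ is not a sink, $\omega(v):=\max\{\omega(\alpha)\mid\alpha\in s^{-1}(v)\}$. Rings of coefficients $R$ are unital. Let $(E^1)^*=\{\alpha_i^*\mid\alpha_i\in E^1\}$, $X=E^0\cup E^1\cup(E^1)^*$, and let $R\langle X\rangle$ be the free (non-unital) $R$-ring on $X$: the free left $R$-module on the nonempty words over $X$ with multiplication $(\sum r_xx)(\sum s_yy)=\sum r_xs_y\,xy$. The weighted Leavitt path algebra $L_R(E,\omega)$ is the quotient of $R\langle X\rangle$ by the ideal generated by the relations: (1) $vw=\delta_{vw}v$ for $v,w\in E^0$; (2) $s(\alpha)\alpha_i=\alpha_ir(\alpha)=\alpha_i$ and $r(\alpha)\alpha_i^*=\alpha_i^*s(\alpha)=\alpha_i^*$ for $\alpha\in E^{\mathrm{st}}$,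 $1\le i\le\omega(\alpha)$; (3) $\sum_{\alpha\in s^{-1}(v)}\alpha_i\alpha_j^*=\delta_{ij}v$ for every non-sink $v$ and $1\le i,j\le\omega(v)$; (4) $\sum_{1\le i\le\max\{\omega(\alpha),\omega(\beta)\}}\alpha_i^*\beta_i=\delta_{\alpha\beta}r(\alpha)$ for all $\alpha,\beta\in E^{\mathrm{st}}$; where in (3) and (4) $\alpha_i:=\alpha_i^*:=0$ whenever $i>\omega(\alpha)$. A generalised path is a single vertex $v$ (with $s(v)=r(v)=v$) or a word $x_1\cdots x_n$, $n\ge1$, $x_i\in E^1\cup(E^1)^*$ with $r(x_i)=s(x_{i+1})$, going from $s(x_1)$ to $r(x_n)$, where $s(\alpha_i)=s(\alpha)$, $r(\alpha_i)=r(\alpha)$, $s(\alpha_i^* )=r(\alpha)$, $r(\alpha_i^* )=s(\alpha)$. An LV-graph is a weighted graph such that $\omega(\alpha)\ge2$ for all $\alpha\in E^{\mathrm{st}}$; $|\{\alpha\in s^{-1}(v)\mid\omega(\alpha)=\omega(v)\}|\ge2$ for every non-sink $v\in E^0$; $E^{\mathrm{st}}\ne\emptyset$; and $(E,\omega)$ is connected, i.e. for any $u,v\in E^0$ there is a generalised path from $u$ to $v$. $L_R(E,\omega)$ has local units but need not be unital; the Jacobson radical of a possibly non-unital ring $A$ is its largest left quasi-regular ideal, where $a\in A$ is left quasi-regular if there is $b\in A$ with $b+a=ba$. *)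

theory Defs
  imports "Graph_Theory.Digraph" "HOL-Algebra.QuotRing" "HOL-Library.Poly_Mapping"
    "HOL-Library.Countable_Set"
begin

section \<open>Possibly non-unital rings\<close>

text \<open>
  A possibly non-unital ring is represented by the record type of HOL-Algebra; its field \<open>one\<close>
  carries no meaning and plays no role in the notions below. The library locale \<^locale>\<open>ideal\<close> requires a
  unital ring, which is why ideals are introduced afresh.
\<close>

definition rng_ideal :: "'a set \<Rightarrow> ('a, 'b) ring_scheme \<Rightarrow> bool" where
  "rng_ideal I A \<longleftrightarrow> additive_subgroup I A \<and>
     (\<forall>a\<in>I. \<forall>x\<in>carrier A. x \<otimes>\<^bsub>A\<^esub> a \<in> I \<and> a \<otimes>\<^bsub>A\<^esub> x \<in> I)"

definition left_quasi_regular :: "('a, 'b) ring_scheme \<Rightarrow> 'a \<Rightarrow> bool" where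
  "left_quasi_regular A a \<longleftrightarrow> (\<exists>b\<in>carrier A. b \<oplus>\<^bsub>A\<^esub> a = b \<otimes>\<^bsub>A\<^esub> a)"

text \<open>The order underlying \<open>GREATEST\<close> is set inclusion.\<close>

definition jacobson_radical :: "('a, 'b) ring_scheme \<Rightarrow> 'a set" where
  "jacobson_radical A = (GREATEST J. rng_ideal J A \<and> (\<forall>a\<in>J. left_quasi_regular A a))"


section \<open>The free non-unital \<open>R\<close>-ring on a set\<close>

definition word_mult ::
    "('x list \<Rightarrow>\<^sub>0 'r::ring_1) \<Rightarrow> ('x list \<Rightarrow>\<^sub>0 'r) \<Rightarrow> ('x list \<Rightarrow>\<^sub>0 'r)" where
  "word_mult f g = (\<Sum>x\<in>Poly_Mapping.keys f. \<Sum>y\<in>Poly_Mapping.keys g.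
     Poly_Mapping.single (x @ y) (Poly_Mapping.lookup f x * Poly_Mapping.lookup g y))"

definition free_rng :: "'x set \<Rightarrow> ('x list \<Rightarrow>\<^sub>0 'r::ring_1) ring" where
  "free_rng X =
     \<lparr>carrier = {f. Poly_Mapping.keys f \<subseteq> lists X - {[]}},
      mult = word_mult, one = undefined, zero = 0, add = (+)\<rparr>"

text \<open>
  Ideals of an \<open>R\<close>-ring are also closed under scalars from \<open>R\<close>. Without a unit this does not
  follow from the other closure properties, and it is needed for the quotient to be an \<open>R\<close>-ring.
\<close>

definition generated_ideal ::
    "'x set \<Rightarrow> ('x list \<Rightarrow>\<^sub>0 'r::ring_1) set \<Rightarrow> ('x list \<Rightarrow>\<^sub>0 'r) set" where
  "generated_ideal X S = \<Inter>{I. rng_ideal I (free_rng X) \<and>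
     (\<forall>r. \<forall>f\<in>I. Poly_Mapping.map ((*) r) f \<in> I) \<and> S \<subseteq> I}"


section \<open>Weighted graphs\<close>

text \<open>
  The arcs of the digraph are the structured edges. The edges \<open>\<alpha>\<^sub>1, \<dots>, \<alpha>\<^sub>n\<close>, \<open>n = \<omega> \<alpha>\<close>, belonging
  to a structured edge \<open>\<alpha>\<close> are \<open>Edge \<alpha> 1, \<dots>, Edge \<alpha> n\<close>, and \<open>Ghost \<alpha> i\<close> stands for \<open>\<alpha>\<^sub>i\<^sup>*\<close>.
\<close>

datatype ('v, 'e) letter = Vertex 'v | Edge 'e nat | Ghost 'e nat

locale weighted_graph = wf_digraph E for E :: "('v, 'e) pre_digraph" +
  fixes \<omega> :: "'e \<Rightarrow> nat"
  assumes countable_verts: "countable (verts E)"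
    and countable_arcs: "countable (arcs E)"
    and weight_pos: "\<alpha> \<in> arcs E \<Longrightarrow> 1 \<le> \<omega> \<alpha>"
    and row_finite: "v \<in> verts E \<Longrightarrow> finite (out_arcs E v)"

definition sink :: "('v, 'e) pre_digraph \<Rightarrow> 'v \<Rightarrow> bool" where
  "sink E v \<longleftrightarrow> out_arcs E v = {}"

definition vertex_weight :: "('v, 'e) pre_digraph \<Rightarrow> ('e \<Rightarrow> nat) \<Rightarrow> 'v \<Rightarrow> nat" where
  "vertex_weight E \<omega> v = Max (\<omega> ` out_arcs E v)"

definition edges :: "('v, 'e) pre_digraph \<Rightarrow> ('e \<Rightarrow> nat) \<Rightarrow> ('v, 'e) letter set" where
  "edges E \<omega> = {Edge \<alpha> i | \<alpha> i. \<alpha> \<in> arcs E \<and> 1 \<le> i \<and> i \<le> \<omega> \<alpha>}"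

definition ghost_edges :: "('v, 'e) pre_digraph \<Rightarrow> ('e \<Rightarrow> nat) \<Rightarrow> ('v, 'e) letter set" where
  "ghost_edges E \<omega> = {Ghost \<alpha> i | \<alpha> i. \<alpha> \<in> arcs E \<and> 1 \<le> i \<and> i \<le> \<omega> \<alpha>}"

fun letter_source :: "('v, 'e) pre_digraph \<Rightarrow> ('v, 'e) letter \<Rightarrow> 'v" where
  "letter_source E (Vertex v) = v"
| "letter_source E (Edge \<alpha> i) = tail E \<alpha>"
| "letter_source E (Ghost \<alpha> i) = head E \<alpha>"

fun letter_range :: "('v, 'e) pre_digraph \<Rightarrow> ('v, 'e) letter \<Rightarrow> 'v" where
  "letter_range E (Vertex v) = v"
| "letter_range E (Edge \<alpha> i) = head E \<alpha>"
| "letter_range E (Ghost \<alpha> i) = tail E \<alpha>"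

definition generalised_path ::
    "('v, 'e) pre_digraph \<Rightarrow> ('e \<Rightarrow> nat) \<Rightarrow> ('v, 'e) letter list \<Rightarrow> bool" where
  "generalised_path E \<omega> p \<longleftrightarrow>
     (\<exists>v\<in>verts E. p = [Vertex v]) \<or>
     (p \<noteq> [] \<and> set p \<subseteq> edges E \<omega> \<union> ghost_edges E \<omega> \<and>
      (\<forall>i. Suc i < length p \<longrightarrow> letter_range E (p ! i) = letter_source E (p ! Suc i)))"

locale lv_graph = weighted_graph E \<omega>
  for E :: "('v, 'e) pre_digraph" and \<omega> :: "'e \<Rightarrow> nat" +
  assumes weight_ge_2: "\<alpha> \<in> arcs E \<Longrightarrow> 2 \<le> \<omega> \<alpha>"
    and two_max_weight: "v \<in> verts E \<Longrightarrow> \<not> sink E v \<Longrightarrow>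
      2 \<le> card {\<alpha> \<in> out_arcs E v. \<omega> \<alpha> = vertex_weight E \<omega> v}"
    and arcs_nonempty: "arcs E \<noteq> {}"
    and connected: "u \<in> verts E \<Longrightarrow> v \<in> verts E \<Longrightarrow>
      \<exists>p. generalised_path E \<omega> p \<and> letter_source E (hd p) = u \<and> letter_range E (last p) = v"


section \<open>Weighted Leavitt path algebras\<close>

definition generators :: "('v, 'e) pre_digraph \<Rightarrow> ('e \<Rightarrow> nat) \<Rightarrow> ('v, 'e) letter set" where
  "generators E \<omega> = Vertex ` verts E \<union> edges E \<omega> \<union> ghost_edges E \<omega>"

definition vertex_elt :: "'v \<Rightarrow> ('v, 'e) letter list \<Rightarrow>\<^sub>0 'r::ring_1" where
  "vertex_elt v = Poly_Mapping.single [Vertex v] 1"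

text \<open>Indices exceeding the weight give \<open>0\<close>.\<close>

definition edge_elt :: "('e \<Rightarrow> nat) \<Rightarrow> 'e \<Rightarrow> nat \<Rightarrow> ('v, 'e) letter list \<Rightarrow>\<^sub>0 'r::ring_1" where
  "edge_elt \<omega> \<alpha> i = (if i \<le> \<omega> \<alpha> then Poly_Mapping.single [Edge \<alpha> i] 1 else 0)"

definition ghost_elt :: "('e \<Rightarrow> nat) \<Rightarrow> 'e \<Rightarrow> nat \<Rightarrow> ('v, 'e) letter list \<Rightarrow>\<^sub>0 'r::ring_1" where
  "ghost_elt \<omega> \<alpha> i = (if i \<le> \<omega> \<alpha> then Poly_Mapping.single [Ghost \<alpha> i] 1 else 0)"

text \<open>A relation \<open>f = g\<close> is encoded by the element \<open>f - g\<close>.\<close>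

definition wlpa_relations ::
    "('v, 'e) pre_digraph \<Rightarrow> ('e \<Rightarrow> nat) \<Rightarrow> (('v, 'e) letter list \<Rightarrow>\<^sub>0 'r::ring_1) set" where
  "wlpa_relations E \<omega> =
     {word_mult (vertex_elt v) (vertex_elt w) - (if v = w then vertex_elt v else 0) | v w.
        v \<in> verts E \<and> w \<in> verts E} \<union>
     (\<Union>\<alpha>\<in>arcs E. \<Union>i\<in>{1..\<omega> \<alpha>}.
        {word_mult (vertex_elt (tail E \<alpha>)) (edge_elt \<omega> \<alpha> i) - edge_elt \<omega> \<alpha> i,
         word_mult (edge_elt \<omega> \<alpha> i) (vertex_elt (head E \<alpha>)) - edge_elt \<omega> \<alpha> i,
         word_mult (vertex_elt (head E \<alpha>)) (ghost_elt \<omega> \<alpha> i) - ghost_elt \<omega> \<alpha> i,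
         word_mult (ghost_elt \<omega> \<alpha> i) (vertex_elt (tail E \<alpha>)) - ghost_elt \<omega> \<alpha> i}) \<union>
     {(\<Sum>\<alpha>\<in>out_arcs E v. word_mult (edge_elt \<omega> \<alpha> i) (ghost_elt \<omega> \<alpha> j))
        - (if i = j then vertex_elt v else 0) | v i j.
        v \<in> verts E \<and> \<not> sink E v \<and>
        i \<in> {1..vertex_weight E \<omega> v} \<and> j \<in> {1..vertex_weight E \<omega> v}} \<union>
     {(\<Sum>i=1..max (\<omega> \<alpha>) (\<omega> \<beta>). word_mult (ghost_elt \<omega> \<alpha> i) (edge_elt \<omega> \<beta> i))
        - (if \<alpha> = \<beta> then vertex_elt (head E \<alpha>) else 0) | \<alpha> \<beta>.
        \<alpha> \<in> arcs E \<and> \<beta> \<in> arcs E}"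

definition weighted_leavitt_path_algebra ::
    "('v, 'e) pre_digraph \<Rightarrow> ('e \<Rightarrow> nat) \<Rightarrow> (('v, 'e) letter list \<Rightarrow>\<^sub>0 'r::ring_1) set ring" where
  "weighted_leavitt_path_algebra E \<omega> =
     free_rng (generators E \<omega>) Quot generated_ideal (generators E \<omega>) (wlpa_relations E \<omega>)"

end

theory Submission
  imports Defs
begin

text \<open>
  Choose at every non-sink \<open>v\<close> a special arc of maximal weight. Orienting relation (3) to eliminate
  \<open>\<alpha>\<^sub>i \<alpha>\<^sub>j\<^sup>*\<close> with \<open>\<alpha>\<close> special and relation (4) to eliminate \<open>\<alpha>\<^sub>1\<^sup>* \<beta>\<^sub>1\<close>, the remaining generalised paths
  form a basis of the algebra: the generators act on the free module over these normal words by a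
  single reduction step, and this action satisfies the relations.

  Let \<open>a\<close> be a nonzero element of a left quasi-regular ideal. By (4) we may multiply by letters so
  that \<open>a\<close> starts at a non-sink \<open>u\<close> and ends at a non-sink \<open>v\<close>. As some arc \<open>\<gamma>\<close> leaving \<open>u\<close> is not
  special and has weight at least 2, every normal word can be followed by \<open>\<gamma>\<^sub>2\<^sup>*\<close>, and \<open>\<gamma>\<^sub>2\<^sup>*\<close> can be
  followed by every normal word starting at \<open>u\<close>, without any reduction. The same freedom at \<open>v\<close> and
  connectedness yield a normal word \<open>c\<close> from \<open>v\<close> to the source \<open>t\<close> of \<open>\<gamma>\<^sub>2\<^sup>*\<close> which can be appended to
  \<open>a\<close>. So if \<open>b + g = b g\<close> for \<open>g = \<gamma>\<^sub>2\<^sup>* a c\<close>, then the normal form of \<open>b g\<close> arises by mere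
  concatenation, and comparing longest words gives \<open>g = 0\<close>.
\<close>

section \<open>Left-linear extension of maps on words\<close>

abbreviation scal :: "'r \<Rightarrow> ('a \<Rightarrow>\<^sub>0 'r::ring_1) \<Rightarrow> ('a \<Rightarrow>\<^sub>0 'r)" where
  "scal r \<equiv> Poly_Mapping.map ((*) r)"

abbreviation wd :: "'a list \<Rightarrow> ('a list \<Rightarrow>\<^sub>0 'r::ring_1)" where
  "wd w \<equiv> Poly_Mapping.single w 1"

lemma lookup_scal [simp]:
  "Poly_Mapping.lookup (scal r f) k = r * Poly_Mapping.lookup f k"
  by (simp add: Poly_Mapping.map.rep_eq when_def)

lemma keys_scal_subset: "Poly_Mapping.keys (scal r f) \<subseteq> Poly_Mapping.keys f"
  by (auto simp: in_keys_iff)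

lemma scal_one [simp]: "scal 1 f = f"
  by (rule poly_mapping_eqI) simp

lemma scal_uminus_one: "scal (-1) f = - f"
  by (rule poly_mapping_eqI) simp

text \<open>Coefficients multiply from the left only: \<open>R\<close> need not be commutative, so
  this is the left \<open>R\<close>-linear map prescribed by \<open>F\<close> on the basis.\<close>

definition lin :: "('a \<Rightarrow> ('b \<Rightarrow>\<^sub>0 'r::ring_1)) \<Rightarrow> ('a \<Rightarrow>\<^sub>0 'r) \<Rightarrow> ('b \<Rightarrow>\<^sub>0 'r)" where
  "lin F f = (\<Sum>x\<in>Poly_Mapping.keys f. scal (Poly_Mapping.lookup f x) (F x))"

lemma lookup_lin:
  "Poly_Mapping.lookup (lin F f) k =
     (\<Sum>x\<in>Poly_Mapping.keys f. Poly_Mapping.lookup f x * Poly_Mapping.lookup (F x) k)"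
  by (simp add: lin_def lookup_sum)

lemma lookup_lin_superset:
  assumes "finite A" "Poly_Mapping.keys f \<subseteq> A"
  shows "Poly_Mapping.lookup (lin F f) k =
     (\<Sum>x\<in>A. Poly_Mapping.lookup f x * Poly_Mapping.lookup (F x) k)"
  unfolding lookup_lin using assms
  by (intro sum.mono_neutral_left) (auto simp: in_keys_iff)

lemma lin_zero [simp]: "lin F 0 = 0"
  by (simp add: lin_def)

lemma lin_single [simp]: "lin F (Poly_Mapping.single x r) = scal r (F x)"
  by (rule poly_mapping_eqI)
    (simp add: lookup_lin_superset[of "{x}"] lookup_single)

lemma lin_add: "lin F (f + g) = lin F f + lin F g"
proof (rule poly_mapping_eqI)
  fix k
  \<comment> \<open>A common support for all three elements; cancellation may make that of
    \<open>f + g\<close> smaller.\<close>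
  let ?A = "Poly_Mapping.keys f \<union> Poly_Mapping.keys g"
  have A: "finite ?A" "Poly_Mapping.keys (f + g) \<subseteq> ?A"
    by (auto dest: set_mp[OF Poly_Mapping.keys_add])
  show "Poly_Mapping.lookup (lin F (f + g)) k = Poly_Mapping.lookup (lin F f + lin F g) k"
    using A by (simp add: lookup_lin_superset[of ?A] lookup_add algebra_simps sum.distrib)
qed

lemma lin_scal: "lin F (scal r f) = scal r (lin F f)"
  by (rule poly_mapping_eqI)
    (simp add: lookup_lin_superset[OF finite_keys keys_scal_subset] lookup_lin[of F f]
      sum_distrib_left mult.assoc)

lemma lin_uminus: "lin F (- f) = - lin F f"
  using lin_scal[of F "-1" f] by (simp only: scal_uminus_one)

lemma lin_diff: "lin F (f - g) = lin F f - lin F g"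
  using lin_add[of F f "- g"] by (simp add: lin_uminus)

lemma lin_sum: "lin F (\<Sum>i\<in>A. f i) = (\<Sum>i\<in>A. lin F (f i))"
  by (induction A rule: infinite_finite_induct) (auto simp: lin_add)

lemma lin_if: "lin F (if P then f else 0) = (if P then lin F f else 0)"
  by simp

lemma lin_cong: "(\<And>x. x \<in> Poly_Mapping.keys f \<Longrightarrow> F x = G x) \<Longrightarrow> lin F f = lin G f"
  by (simp add: lin_def)

lemma lin_lin: "lin G (lin F f) = lin (\<lambda>x. lin G (F x)) f"
  unfolding lin_def[of F] lin_def[of "\<lambda>x. lin G (F x)"] by (simp add: lin_sum lin_scal)

lemma lin_singles [simp]: "lin (\<lambda>x. Poly_Mapping.single x 1) f = f"
proof (rule poly_mapping_eqI)
  fix k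
  have "Poly_Mapping.lookup (lin (\<lambda>x. Poly_Mapping.single x 1) f) k =
      (\<Sum>x\<in>Poly_Mapping.keys f. if x = k then Poly_Mapping.lookup f x else 0)"
    unfolding lookup_lin by (intro sum.cong refl) (simp add: lookup_single when_def)
  then show "Poly_Mapping.lookup (lin (\<lambda>x. Poly_Mapping.single x 1) f) k = Poly_Mapping.lookup f k"
    by (simp add: in_keys_iff)
qed

lemma lin_diff_fun: "lin (\<lambda>x. F x - G x) f = lin F f - lin G f"
  by (rule poly_mapping_eqI) (simp add: lookup_lin lookup_minus algebra_simps sum_subtractf)

lemma lin_add_fun: "lin (\<lambda>x. F x + G x) f = lin F f + lin G f"
  by (rule poly_mapping_eqI) (simp add: lookup_lin lookup_add algebra_simps sum.distrib)

lemma lin_zero_fun [simp]: "lin (\<lambda>_. 0) n = 0"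
  by (rule poly_mapping_eqI) (simp add: lookup_lin)

lemma lin_sum_fun: "lin (\<lambda>x. \<Sum>i\<in>A. F i x) f = (\<Sum>i\<in>A. lin (F i) f)"
  by (induction A rule: infinite_finite_induct) (auto simp: lin_add_fun)

lemma keys_lin: "Poly_Mapping.keys (lin F f) \<subseteq> (\<Union>x\<in>Poly_Mapping.keys f. Poly_Mapping.keys (F x))"
  unfolding lin_def
  by (rule order.trans[OF keys_sum UN_mono[OF order.refl keys_scal_subset]])

text \<open>Injectivity on the support rules out cancellation, so every coefficient survives the
  relabelling. This will show that an element stays nonzero after its words are extended at both
  ends.\<close>

lemma lookup_lin_wd_inj:
  fixes n :: "'a list \<Rightarrow>\<^sub>0 'r::ring_1"
  assumes "inj_on \<phi> (Poly_Mapping.keys n)" "w \<in> Poly_Mapping.keys n"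
  shows "Poly_Mapping.lookup (lin (\<lambda>w. wd (\<phi> w)) n) (\<phi> w) = Poly_Mapping.lookup n w"
proof -
  have "Poly_Mapping.lookup (lin (\<lambda>w. wd (\<phi> w)) n) (\<phi> w) =
      (\<Sum>x\<in>Poly_Mapping.keys n. if x = w then Poly_Mapping.lookup n x else 0)"
    unfolding lookup_lin using assms
    by (intro sum.cong refl) (auto simp: lookup_single when_def inj_on_def)
  then show ?thesis using assms(2) by simp
qed

text \<open>Writing the product as a nested linear extension reduces distributivity and
  associativity to the rules for \<open>lin\<close>. The coefficients meet in the order
  \<open>r * s\<close>, as they must without commutativity.\<close>

lemma word_mult_eq_lin:
  "word_mult f g = lin (\<lambda>x. lin (\<lambda>y. Poly_Mapping.single (x @ y) 1) g) f"
proof -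
  have "scal r (scal s (Poly_Mapping.single z 1)) = Poly_Mapping.single z (r * s)"
    for r s :: 'b and z :: "'a list"
    by (rule poly_mapping_eqI) (simp add: lookup_single when_def)
  moreover have "scal r (\<Sum>i\<in>A. h i) = (\<Sum>i\<in>A. scal r (h i))"
    for r :: 'b and A :: "'a list set" and h :: "'a list \<Rightarrow> 'a list \<Rightarrow>\<^sub>0 'b"
    by (rule poly_mapping_eqI) (simp add: lookup_sum sum_distrib_left)
  ultimately show ?thesis by (simp add: word_mult_def lin_def)
qed

lemma word_mult_single_left:
  "word_mult (Poly_Mapping.single x 1) g = lin (\<lambda>y. Poly_Mapping.single (x @ y) 1) g"
  by (simp add: word_mult_eq_lin)

lemma word_mult_single_right:
  "word_mult f (Poly_Mapping.single y 1) = lin (\<lambda>x. Poly_Mapping.single (x @ y) 1) f"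
  by (simp add: word_mult_eq_lin)

lemma word_mult_single [simp]:
  "word_mult (Poly_Mapping.single x 1) (Poly_Mapping.single y 1) = Poly_Mapping.single (x @ y) 1"
  by (simp add: word_mult_eq_lin)

lemma word_mult_diff_left: "word_mult (f - g) h = word_mult f h - word_mult g h"
  by (simp add: word_mult_eq_lin lin_diff)

lemma word_mult_zero_left [simp]: "word_mult 0 h = 0"
  by (simp add: word_mult_eq_lin)

lemma word_mult_zero_right [simp]: "word_mult h 0 = 0"
  by (simp add: word_mult_def)

lemma word_mult_sum_left: "word_mult (\<Sum>i\<in>A. f i) h = (\<Sum>i\<in>A. word_mult (f i) h)"
  by (simp add: word_mult_eq_lin lin_sum)

lemma word_mult_sum_right: "word_mult h (\<Sum>i\<in>A. f i) = (\<Sum>i\<in>A. word_mult h (f i))"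
  by (simp add: word_mult_eq_lin lin_sum lin_sum_fun)

lemma word_mult_diff_right: "word_mult h (f - g) = word_mult h f - word_mult h g"
  by (simp add: word_mult_eq_lin lin_diff lin_diff_fun)

lemma word_mult_assoc: "word_mult (word_mult f g) h = word_mult f (word_mult g h)"
  by (simp add: word_mult_eq_lin lin_lin)


section \<open>The free ring and its quotients\<close>

definition words :: "'x set \<Rightarrow> ('x list \<Rightarrow>\<^sub>0 'r::ring_1) set" where
  "words X = {f. Poly_Mapping.keys f \<subseteq> lists X - {[]}}"

lemma words_zero [simp]: "0 \<in> words X"
  by (simp add: words_def)

lemma words_single: "x \<in> lists X \<Longrightarrow> x \<noteq> [] \<Longrightarrow> Poly_Mapping.single x r \<in> words X"
  by (auto simp: words_def)

lemma words_add: "f \<in> words X \<Longrightarrow> g \<in> words X \<Longrightarrow> f + g \<in> words X"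
  unfolding words_def using Poly_Mapping.keys_add[of f g] by blast

lemma words_uminus: "f \<in> words X \<Longrightarrow> - f \<in> words X"
  by (simp add: words_def)

lemma words_diff: "f \<in> words X \<Longrightarrow> g \<in> words X \<Longrightarrow> f - g \<in> words X"
  using words_add[of f X "- g"] words_uminus[of g X] by simp

lemma words_scal: "f \<in> words X \<Longrightarrow> scal r f \<in> words X"
  unfolding words_def using keys_scal_subset[of r f] by blast

lemma words_sum: "(\<And>i. i \<in> A \<Longrightarrow> f i \<in> words X) \<Longrightarrow> (\<Sum>i\<in>A. f i) \<in> words X"
  by (induction A rule: infinite_finite_induct) (auto simp: words_add)

lemma words_lin: "(\<And>x. x \<in> Poly_Mapping.keys f \<Longrightarrow> F x \<in> words X) \<Longrightarrow> lin F f \<in> words X"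
  unfolding lin_def by (intro words_sum words_scal)

lemma words_mult: "f \<in> words X \<Longrightarrow> g \<in> words X \<Longrightarrow> word_mult f g \<in> words X"
  unfolding word_mult_eq_lin
  by (intro words_lin words_single) (auto simp: words_def subset_iff)

lemma free_rng_simps [simp]:
  "carrier (free_rng X) = words X" "mult (free_rng X) = word_mult"
  "zero (free_rng X) = 0" "add (free_rng X) = (+)"
  by (simp_all add: free_rng_def words_def)

lemma abelian_group_free_rng:
  "abelian_group (free_rng X :: ('x list \<Rightarrow>\<^sub>0 'r::ring_1) ring)"
proof (rule abelian_groupI)
  fix f :: "'x list \<Rightarrow>\<^sub>0 'r"
  assume "f \<in> carrier (free_rng X)"
  then show "\<exists>g\<in>carrier (free_rng X). g \<oplus>\<^bsub>free_rng X\<^esub> f = \<zero>\<^bsub>free_rng X\<^esub>"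
    by (intro bexI[of _ "- f"]) (auto simp: words_uminus)
qed (auto simp: words_add algebra_simps)

lemma a_inv_free_rng: "f \<in> words X \<Longrightarrow> \<ominus>\<^bsub>free_rng X\<^esub> f = - f"
  by (rule abelian_group.minus_equality[OF abelian_group_free_rng]) (simp_all add: words_uminus)

lemma rng_ideal_free_rng_iff:
  "rng_ideal I (free_rng X) \<longleftrightarrow>
     I \<subseteq> words X \<and> 0 \<in> I \<and> (\<forall>f\<in>I. \<forall>g\<in>I. f + g \<in> I) \<and> (\<forall>f\<in>I. - f \<in> I) \<and>
     (\<forall>f\<in>I. \<forall>g\<in>words X. word_mult g f \<in> I \<and> word_mult f g \<in> I)"
proof -
  interpret abelian_group "free_rng X" by (rule abelian_group_free_rng)
  have "inv\<^bsub>add_monoid (free_rng X)\<^esub> f = - f" if "f \<in> words X" for f :: "'a list \<Rightarrow>\<^sub>0 'b"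
    using a_inv_free_rng[OF that] by (simp add: a_inv_def)
  then show ?thesis
    unfolding rng_ideal_def additive_subgroup_def subgroup_def
    by (auto 0 3 simp: subset_iff)
qed

section \<open>Congruence modulo an ideal closed under scalars, and the quotient ring\<close>

locale words_ideal =
  fixes X :: "'x set" and I :: "('x list \<Rightarrow>\<^sub>0 'r::ring_1) set"
  assumes ideal: "rng_ideal I (free_rng X)"
    and scal_closed: "f \<in> I \<Longrightarrow> scal r f \<in> I"
begin

lemma ideal_words: "f \<in> I \<Longrightarrow> f \<in> words X"
  and ideal_zero: "0 \<in> I"
  and ideal_add: "f \<in> I \<Longrightarrow> g \<in> I \<Longrightarrow> f + g \<in> I"
  and ideal_uminus: "f \<in> I \<Longrightarrow> - f \<in> I"
  and ideal_mult_left: "f \<in> I \<Longrightarrow> g \<in> words X \<Longrightarrow> word_mult g f \<in> I"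
  and ideal_mult_right: "f \<in> I \<Longrightarrow> g \<in> words X \<Longrightarrow> word_mult f g \<in> I"
  using ideal unfolding rng_ideal_free_rng_iff by blast+

lemma ideal_diff: "f \<in> I \<Longrightarrow> g \<in> I \<Longrightarrow> f - g \<in> I"
  using ideal_add[of f "- g"] ideal_uminus[of g] by simp

lemma ideal_sum: "(\<And>i. i \<in> A \<Longrightarrow> f i \<in> I) \<Longrightarrow> (\<Sum>i\<in>A. f i) \<in> I"
  by (induction A rule: infinite_finite_induct) (auto simp: ideal_add ideal_zero)

lemma ideal_lin: "(\<And>x. x \<in> Poly_Mapping.keys f \<Longrightarrow> F x \<in> I) \<Longrightarrow> lin F f \<in> I"
  unfolding lin_def by (intro ideal_sum scal_closed)

definition cong :: "('x list \<Rightarrow>\<^sub>0 'r) \<Rightarrow> ('x list \<Rightarrow>\<^sub>0 'r) \<Rightarrow> bool"  (infix "\<approx>" 50) where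
  "f \<approx> g \<longleftrightarrow> f - g \<in> I"

lemma cong_refl [simp]: "f \<approx> f"
  by (simp add: cong_def ideal_zero)

lemma cong_sym: "f \<approx> g \<Longrightarrow> g \<approx> f"
  using ideal_uminus[of "f - g"] by (simp add: cong_def)

lemma cong_trans [trans]: "f \<approx> g \<Longrightarrow> g \<approx> h \<Longrightarrow> f \<approx> h"
  using ideal_add[of "f - g" "g - h"] by (simp add: cong_def)

lemma cong_ideal: "f \<approx> g \<Longrightarrow> f \<in> I \<longleftrightarrow> g \<in> I"
  unfolding cong_def using ideal_add[of "f - g" g] ideal_diff[of f "f - g"] by auto

lemma cong_zero: "f \<approx> 0 \<longleftrightarrow> f \<in> I"
  by (simp add: cong_def)

lemma cong_sum: "(\<And>i. i \<in> A \<Longrightarrow> f i \<approx> g i) \<Longrightarrow> (\<Sum>i\<in>A. f i) \<approx> (\<Sum>i\<in>A. g i)"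
  unfolding cong_def sum_subtractf[symmetric] by (rule ideal_sum)

lemma cong_mult_left: "f \<approx> g \<Longrightarrow> h \<in> words X \<Longrightarrow> word_mult h f \<approx> word_mult h g"
  using ideal_mult_left[of "f - g" h] by (simp add: cong_def word_mult_diff_right)

lemma cong_mult_right: "f \<approx> g \<Longrightarrow> h \<in> words X \<Longrightarrow> word_mult f h \<approx> word_mult g h"
  using ideal_mult_right[of "f - g" h] by (simp add: cong_def word_mult_diff_left)

lemma cong_lin: "(\<And>x. x \<in> Poly_Mapping.keys f \<Longrightarrow> F x \<approx> G x) \<Longrightarrow> lin F f \<approx> lin G f"
  unfolding cong_def lin_diff_fun[symmetric] by (rule ideal_lin)

abbreviation coset :: "('x list \<Rightarrow>\<^sub>0 'r) \<Rightarrow> ('x list \<Rightarrow>\<^sub>0 'r) set" where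
  "coset f \<equiv> I +>\<^bsub>free_rng X\<^esub> f"

lemma mem_coset: "g \<in> coset f \<longleftrightarrow> g \<approx> f"
  unfolding a_r_coset_def' cong_def
  by (auto intro: bexI[of _ "g - f"])

lemma coset_eq_iff: "coset f = coset g \<longleftrightarrow> f \<approx> g"
  unfolding set_eq_iff mem_coset using cong_refl cong_sym cong_trans by blast

lemma coset_zero: "coset 0 = I"
  by (auto simp: mem_coset cong_zero)

lemma carrier_quot: "carrier (free_rng X Quot I) = coset ` words X"
  by (auto simp: FactRing_def A_RCOSETS_def')

lemma zero_quot: "\<zero>\<^bsub>free_rng X Quot I\<^esub> = I"
  by (simp add: FactRing_def)

lemma ideal_in_quot: "I \<in> carrier (free_rng X Quot I)"
proof -
  have "coset 0 \<in> coset ` words X" by (rule imageI) simp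
  then show ?thesis by (simp only: carrier_quot coset_zero)
qed

lemma add_quot: "coset f \<oplus>\<^bsub>free_rng X Quot I\<^esub> coset g = coset (f + g)"
proof (rule Set.set_eqI, rule iffI)
  fix h
  assume "h \<in> coset f \<oplus>\<^bsub>free_rng X Quot I\<^esub> coset g"
  then obtain f' g' where "f' \<approx> f" "g' \<approx> g" "h = f' + g'"
    by (auto simp: FactRing_def set_add_def' mem_coset)
  then show "h \<in> coset (f + g)"
    using ideal_add[of "f' - f" "g' - g"] by (simp add: mem_coset cong_def algebra_simps)
next
  fix h
  assume "h \<in> coset (f + g)"
  then have "h - g \<in> coset f" "g \<in> coset g"
    by (simp_all add: mem_coset cong_def algebra_simps ideal_zero)
  then have "\<exists>x\<in>coset f. \<exists>y\<in>coset g. h = x + y"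
    by (intro bexI[of _ "h - g"] bexI[of _ g]) simp_all
  then show "h \<in> coset f \<oplus>\<^bsub>free_rng X Quot I\<^esub> coset g"
    by (simp add: FactRing_def set_add_def')
qed

lemma mult_quot:
  assumes "f \<in> words X" "g \<in> words X"
  shows "coset f \<otimes>\<^bsub>free_rng X Quot I\<^esub> coset g = coset (word_mult f g)"
proof -
  have mult: "coset (word_mult f' g') = coset (word_mult f g)" if "f' \<approx> f" "g' \<approx> g" for f' g'
  proof -
    \<comment> \<open>A representative of the coset of \<open>f\<close> lies in the free ring
      because \<open>I\<close> does; the relation \<open>\<approx>\<close> alone speaks about
      arbitrary polynomial mappings.\<close>
    have "f' \<in> words X"
      using words_add[OF ideal_words assms(1), of "f' - f"] that(1) by (simp add: cong_def)
    then have "word_mult f' g' \<approx> word_mult f' g" "word_mult f' g \<approx> word_mult f g"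
      using that assms cong_mult_left cong_mult_right by blast+
    then show ?thesis unfolding coset_eq_iff by (rule cong_trans)
  qed
  \<comment> \<open>The product of cosets is a union over all pairs of representatives; all its
    members are the same coset, and there is at least one pair.\<close>
  have "(\<Union>a\<in>coset f. \<Union>b\<in>coset g. coset (word_mult a b)) =
      (\<Union>a\<in>coset f. \<Union>b\<in>coset g. coset (word_mult f g))"
    by (intro SUP_cong refl mult) (simp_all add: mem_coset)
  moreover have "f \<in> coset f" "g \<in> coset g"
    by (simp_all add: mem_coset)
  ultimately show ?thesis
    unfolding FactRing_def rcoset_mult_def by auto
qed

lemma additive_subgroup_quot_zero: "additive_subgroup {I} (free_rng X Quot I)"
proof -
  let ?A = "free_rng X Quot I"
  have add: "I \<oplus>\<^bsub>?A\<^esub> I = I"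
    using add_quot[of 0 0] by (simp add: coset_zero)
  have "inv\<^bsub>add_monoid ?A\<^esub> I = I"
    unfolding m_inv_def
  proof (rule the_equality)
    show "I \<in> carrier (add_monoid ?A) \<and> I \<otimes>\<^bsub>add_monoid ?A\<^esub> I = \<one>\<^bsub>add_monoid ?A\<^esub> \<and>
        I \<otimes>\<^bsub>add_monoid ?A\<^esub> I = \<one>\<^bsub>add_monoid ?A\<^esub>"
      using add ideal_in_quot by (simp add: zero_quot)
  next
    \<comment> \<open>An additive inverse \<open>Y\<close> of \<open>I\<close> is a coset, and the
      coset of \<open>0\<close> is neutral, so \<open>Y = I\<close>.\<close>
    fix Y
    assume Y: "Y \<in> carrier (add_monoid ?A) \<and> I \<otimes>\<^bsub>add_monoid ?A\<^esub> Y = \<one>\<^bsub>add_monoid ?A\<^esub> \<and>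
        Y \<otimes>\<^bsub>add_monoid ?A\<^esub> I = \<one>\<^bsub>add_monoid ?A\<^esub>"
    then obtain f where f: "Y = coset f" by (auto simp: carrier_quot)
    then have "I \<oplus>\<^bsub>?A\<^esub> coset f = I" using Y by (simp add: zero_quot)
    then show "Y = I" using add_quot[of 0 f] f by (simp add: coset_zero)
  qed
  then show ?thesis
    using add ideal_in_quot by (simp add: additive_subgroup_def subgroup_def zero_quot)
qed

text \<open>\<open>{I}\<close> is the zero ideal of the quotient and is itself left quasi-regular,
  with \<open>b = 0\<close>. Once every left quasi-regular ideal lies in it, it is the greatest one,
  so the existence of the maximum behind \<open>GREATEST\<close> is obtained along the way.\<close>

lemma jacobson_radical_quot_eq_zeroI:
  assumes "\<And>J f. rng_ideal J (free_rng X Quot I) \<Longrightarrow>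
      (\<And>a. a \<in> J \<Longrightarrow> left_quasi_regular (free_rng X Quot I) a) \<Longrightarrow>
      f \<in> words X \<Longrightarrow> coset f \<in> J \<Longrightarrow> f \<in> I"
  shows "jacobson_radical (free_rng X Quot I) = {\<zero>\<^bsub>free_rng X Quot I\<^esub>}"
  unfolding jacobson_radical_def zero_quot
proof (rule Greatest_equality)
  have "coset f \<otimes>\<^bsub>free_rng X Quot I\<^esub> I = I" "I \<otimes>\<^bsub>free_rng X Quot I\<^esub> coset f = I"
    if "f \<in> words X" for f
    using mult_quot[OF that words_zero] mult_quot[OF words_zero that] by (simp_all add: coset_zero)
  moreover have "left_quasi_regular (free_rng X Quot I) I"
    unfolding left_quasi_regular_def
    using add_quot[of 0 0] mult_quot[of 0 0] ideal_in_quot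
    by (intro bexI[of _ I]) (simp_all add: coset_zero)
  ultimately show "rng_ideal {I} (free_rng X Quot I) \<and>
      (\<forall>a\<in>{I}. left_quasi_regular (free_rng X Quot I) a)"
    using additive_subgroup_quot_zero by (auto simp: rng_ideal_def carrier_quot)
next
  fix J
  assume J: "rng_ideal J (free_rng X Quot I) \<and>
      (\<forall>a\<in>J. left_quasi_regular (free_rng X Quot I) a)"
  show "J \<le> {I}"
  proof
    fix a
    assume a: "a \<in> J"
    moreover have "J \<subseteq> carrier (free_rng X Quot I)"
      using J by (simp add: rng_ideal_def additive_subgroup.a_subset)
    ultimately obtain f where f: "f \<in> words X" "a = coset f"
      by (auto simp: carrier_quot)
    then have "f \<in> I" using assms[of J f] J a by blast
    then have "coset f = coset 0" by (simp only: coset_eq_iff cong_zero)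
    then show "a \<in> {I}" using f by (simp add: coset_zero)
  qed
qed

end

lemma words_ideal_generated_ideal:
  assumes "S \<subseteq> words X"
  shows "words_ideal X (generated_ideal X S)"
proof
  let ?C = "{I. rng_ideal I (free_rng X) \<and> (\<forall>r. \<forall>f\<in>I. scal r f \<in> I) \<and> S \<subseteq> I}"
  \<comment> \<open>The free ring itself is one of the intersected ideals, so the family is not
    empty and the intersection stays inside the free ring.\<close>
  have "words X \<in> ?C"
    using assms
    by (simp add: rng_ideal_free_rng_iff words_add words_uminus words_mult words_scal)
  then have "\<Inter>?C \<subseteq> words X" by (rule Inter_lower)
  then show "rng_ideal (generated_ideal X S) (free_rng X)"
    unfolding generated_ideal_def rng_ideal_free_rng_iff
    by (intro conjI ballI InterI) (simp_all add: rng_ideal_free_rng_iff)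
  show "scal r f \<in> generated_ideal X S" if "f \<in> generated_ideal X S" for r f
    using that by (auto simp: generated_ideal_def)
qed

lemma generated_ideal_superset: "S \<subseteq> generated_ideal X S"
  by (auto simp: generated_ideal_def)

lemma generated_ideal_minimal:
  "words_ideal X I \<Longrightarrow> S \<subseteq> I \<Longrightarrow> generated_ideal X S \<subseteq> I"
  unfolding generated_ideal_def using words_ideal.ideal words_ideal.scal_closed by blast


section \<open>Normal words and the action of letters\<close>

lemma Edge_not_Vertex [simp]: "Edge \<alpha> i \<notin> range Vertex"
  and Ghost_not_Vertex [simp]: "Ghost \<alpha> i \<notin> range Vertex"
  by auto

text \<open>Maximality of the weight guarantees that
  \<open>\<alpha>\<^sub>i \<alpha>\<^sub>j\<^sup>*\<close> with \<open>\<alpha> = sp v\<close>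
  occurs in relation (3) for all \<open>i, j\<close> up to the weight of \<open>v\<close>, so that
  the relation can be solved for it.\<close>

locale special_arcs = weighted_graph E \<omega>
  for E :: "('v, 'e) pre_digraph" and \<omega> :: "'e \<Rightarrow> nat" +
  fixes sp :: "'v \<Rightarrow> 'e"
  assumes special: "v \<in> verts E \<Longrightarrow> \<not> sink E v \<Longrightarrow>
    sp v \<in> out_arcs E v \<and> \<omega> (sp v) = vertex_weight E \<omega> v"
begin

abbreviation X where "X \<equiv> generators E \<omega>"
abbreviation src where "src \<equiv> letter_source E"
abbreviation rng where "rng \<equiv> letter_range E"

text \<open>The leading words of the oriented relations. The first kind depends on indices alone,
  the second on arcs alone; composability of the two letters is checked separately by
  \<open>normal\<close> and \<open>act1\<close>.\<close>

fun forbidden :: "('v, 'e) letter \<Rightarrow> ('v, 'e) letter \<Rightarrow> bool" where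
  "forbidden (Ghost \<alpha> i) (Edge \<beta> j) \<longleftrightarrow> i = 1 \<and> j = 1"
| "forbidden (Edge \<alpha> i) (Ghost \<beta> j) \<longleftrightarrow> \<alpha> = \<beta> \<and> \<alpha> = sp (tail E \<alpha>)"
| "forbidden _ _ \<longleftrightarrow> False"

text \<open>
  A normal word ends in a vertex, and this is its only vertex. Thus \<open>v\<close> is represented by
  \<open>[v]\<close> and a path \<open>p\<close> with range \<open>v\<close> by \<open>pv\<close>, so that the source of a normal word can always be read
  off its first letter.
\<close>

inductive normal :: "('v, 'e) letter list \<Rightarrow> bool" where
  normal_vertex: "v \<in> verts E \<Longrightarrow> normal [Vertex v]"
| normal_Cons: "normal w \<Longrightarrow> x \<in> edges E \<omega> \<union> ghost_edges E \<omega> \<Longrightarrow> rng x = src (hd w) \<Longrightarrow>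
    \<not> forbidden x (hd w) \<Longrightarrow> normal (x # w)"

text \<open>What a leading pair in front of \<open>w\<close> is rewritten to, namely the relation
  solved for that pair. In a leading pair of a ghost and an edge both indices are \<open>1\<close>,
  so the remaining sum starts at \<open>2\<close>.\<close>

fun reduct :: "('v, 'e) letter \<Rightarrow> ('v, 'e) letter \<Rightarrow> ('v, 'e) letter list \<Rightarrow>
    (('v, 'e) letter list \<Rightarrow>\<^sub>0 'r::ring_1)" where
  "reduct (Ghost \<alpha> i) (Edge \<beta> j) w = (if \<alpha> = \<beta> then wd w else 0) -
     (\<Sum>k=2..min (\<omega> \<alpha>) (\<omega> \<beta>). wd (Ghost \<alpha> k # Edge \<beta> k # w))"
| "reduct (Edge \<alpha> i) (Ghost \<beta> j) w = (if i = j then wd w else 0) -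
     (\<Sum>\<eta>\<in>out_arcs E (tail E \<alpha>) - {\<alpha>}.
        if i \<le> \<omega> \<eta> \<and> j \<le> \<omega> \<eta> then wd (Edge \<eta> i # Ghost \<eta> j # w) else 0)"
| "reduct _ _ _ = 0"

text \<open>Left multiplication of a normal word by a letter. Letters that do not fit give
  \<open>0\<close> because distinct vertices are orthogonal, and a vertex acts as a
  projection.\<close>

definition act1 :: "('v, 'e) letter \<Rightarrow> ('v, 'e) letter list \<Rightarrow>
    (('v, 'e) letter list \<Rightarrow>\<^sub>0 'r::ring_1)" where
  "act1 x w = (if rng x \<noteq> src (hd w) then 0 else if x \<in> range Vertex then wd w
     else if forbidden x (hd w) then reduct x (hd w) (tl w) else wd (x # w))"

primrec act :: "('v, 'e) letter list \<Rightarrow> (('v, 'e) letter list \<Rightarrow>\<^sub>0 'r::ring_1) \<Rightarrow>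
    (('v, 'e) letter list \<Rightarrow>\<^sub>0 'r)" where
  "act [] n = n"
| "act (x # xs) n = lin (act1 x) (act xs n)"

definition apply_poly :: "(('v, 'e) letter list \<Rightarrow>\<^sub>0 'r::ring_1) \<Rightarrow> (('v, 'e) letter list \<Rightarrow>\<^sub>0 'r) \<Rightarrow>
    (('v, 'e) letter list \<Rightarrow>\<^sub>0 'r)"  (infixr "\<star>" 75) where
  "f \<star> n = lin (\<lambda>xs. act xs n) f"

lemma act_eq_lin: "act xs n = lin (\<lambda>w. act xs (wd w)) n"
proof (induction xs)
  case (Cons x xs)
  have "act (x # xs) n = lin (act1 x) (lin (\<lambda>w. act xs (wd w)) n)"
    using Cons by simp
  then show ?case by (simp add: lin_lin)
qed simp

lemma act_lin: "act xs (lin F n) = lin (\<lambda>w. act xs (F w)) n"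
  by (subst (1 2) act_eq_lin) (simp add: lin_lin)

lemma act_append: "act (xs @ ys) n = act xs (act ys n)"
  by (induction xs) simp_all

lemma apply_mult: "word_mult f g \<star> n = f \<star> g \<star> n"
  by (simp add: apply_poly_def word_mult_eq_lin lin_lin act_append act_lin)

lemma apply_wd: "wd xs \<star> n = act xs n"
  by (simp add: apply_poly_def)

lemma apply_zero [simp]: "0 \<star> n = 0"
  by (simp add: apply_poly_def)

lemma apply_add: "(f + g) \<star> n = f \<star> n + g \<star> n"
  by (simp add: apply_poly_def lin_add)

lemma apply_diff: "(f - g) \<star> n = f \<star> n - g \<star> n"
  by (simp add: apply_poly_def lin_diff)

lemma apply_uminus: "(- f) \<star> n = - (f \<star> n)"
  by (simp add: apply_poly_def lin_uminus)

lemma apply_scal: "scal r f \<star> n = scal r (f \<star> n)"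
  by (simp add: apply_poly_def lin_scal)

lemma apply_sum: "(\<Sum>i\<in>A. f i) \<star> n = (\<Sum>i\<in>A. f i \<star> n)"
  by (simp add: apply_poly_def lin_sum)

lemma forbidden_Edge_index: "forbidden (Edge \<alpha> i) y \<longleftrightarrow> forbidden (Edge \<alpha> j) y"
  by (cases y) auto

lemma forbidden_Ghost_arc: "forbidden (Ghost \<alpha> i) y \<longleftrightarrow> forbidden (Ghost \<beta> i) y"
  by (cases y) auto

lemma Edge_in_X: "Edge \<alpha> i \<in> X \<longleftrightarrow> \<alpha> \<in> arcs E \<and> 1 \<le> i \<and> i \<le> \<omega> \<alpha>"
  and Ghost_in_X: "Ghost \<alpha> i \<in> X \<longleftrightarrow> \<alpha> \<in> arcs E \<and> 1 \<le> i \<and> i \<le> \<omega> \<alpha>"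
  and Vertex_in_X: "Vertex v \<in> X \<longleftrightarrow> v \<in> verts E"
  by (auto simp: generators_def edges_def ghost_edges_def)

lemma edges_ghosts_eq: "edges E \<omega> \<union> ghost_edges E \<omega> = X - range Vertex"
  by (auto simp: generators_def edges_def ghost_edges_def)

lemma src_in_verts: "x \<in> X \<Longrightarrow> src x \<in> verts E"
  and rng_in_verts: "x \<in> X \<Longrightarrow> rng x \<in> verts E"
  by (cases x; simp add: Edge_in_X Ghost_in_X Vertex_in_X)+

lemma normal_not_Nil: "normal w \<Longrightarrow> w \<noteq> []"
  by (erule normal.cases) auto

lemma normal_lists: "normal w \<Longrightarrow> w \<in> lists X"
  by (induction rule: normal.induct) (auto simp: generators_def)

lemma normal_Cons_iff:
  "x \<notin> range Vertex \<Longrightarrow> normal (x # w) \<longleftrightarrow>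
     normal w \<and> x \<in> X \<and> rng x = src (hd w) \<and> \<not> forbidden x (hd w)"
  by (subst normal.simps) (auto simp: generators_def)

lemma normal_Edge_iff:
  "normal (Edge \<alpha> i # w) \<longleftrightarrow> normal w \<and> \<alpha> \<in> arcs E \<and> 1 \<le> i \<and> i \<le> \<omega> \<alpha> \<and>
     head E \<alpha> = src (hd w) \<and> \<not> forbidden (Edge \<alpha> i) (hd w)"
  by (subst normal_Cons_iff) (auto simp: Edge_in_X)

lemma normal_Ghost_iff:
  "normal (Ghost \<alpha> i # w) \<longleftrightarrow> normal w \<and> \<alpha> \<in> arcs E \<and> 1 \<le> i \<and> i \<le> \<omega> \<alpha> \<and>
     tail E \<alpha> = src (hd w) \<and> \<not> forbidden (Ghost \<alpha> i) (hd w)"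
  by (subst normal_Cons_iff) (auto simp: Ghost_in_X)

lemma weight_le_vertex_weight:
  "\<alpha> \<in> arcs E \<Longrightarrow> \<omega> \<alpha> \<le> vertex_weight E \<omega> (tail E \<alpha>)"
  unfolding vertex_weight_def by (intro Max_ge) (auto simp: row_finite)

lemma not_sink_tail: "\<alpha> \<in> arcs E \<Longrightarrow> \<not> sink E (tail E \<alpha>)"
  by (auto simp: sink_def)

lemma weight_le_special:
  assumes "\<alpha> \<in> arcs E"
  shows "\<omega> \<alpha> \<le> \<omega> (sp (tail E \<alpha>))"
  using special[of "tail E \<alpha>"] not_sink_tail[OF assms] weight_le_vertex_weight[OF assms] assms
  by auto

text \<open>One reduction step already yields normal words. The new first pair is not forbidden,
  having index at least \<open>2\<close> or a non-special arc. The pair behind it changes only in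
  what \<open>forbidden\<close> ignores: the arc of a ghost or the index of an edge in first
  position. The right end is untouched.\<close>

lemma keys_act1:
  assumes "normal w" "x \<in> X" "w' \<in> Poly_Mapping.keys (act1 x w :: _ \<Rightarrow>\<^sub>0 'r::ring_1)"
  shows "normal w' \<and> src (hd w') = src x \<and> last w' = last w"
proof -
  have rng: "rng x = src (hd w)"
    using assms(3) by (auto simp: act1_def split: if_splits)
  consider (vertex) "x \<in> range Vertex" | (forb) "x \<notin> range Vertex" "forbidden x (hd w)"
    | (free) "x \<notin> range Vertex" "\<not> forbidden x (hd w)"
    by blast
  then show ?thesis
  proof cases
    case vertex
    then show ?thesis using assms rng by (auto simp: act1_def)
  next
    case free
    then show ?thesis using assms rng normal_not_Nil[OF assms(1)] by (auto simp: act1_def normal_Cons_iff)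
  next
    case forb
    then have w': "w' \<in> Poly_Mapping.keys (reduct x (hd w) (tl w) :: _ \<Rightarrow>\<^sub>0 'r)"
      using assms rng by (auto simp: act1_def)
    have w: "w = hd w # tl w" using normal_not_Nil[OF assms(1)] by simp
    show ?thesis
    proof (cases x)
      case (Vertex v)
      then show ?thesis using forb by auto
    next
      case (Edge \<alpha> i)
      then obtain j where y: "hd w = Ghost \<alpha> j" and \<alpha>: "\<alpha> = sp (tail E \<alpha>)"
        using forb by (cases "hd w") auto
      have n: "normal (Ghost \<alpha> j # tl w)" using assms(1) w y by simp
      then have "tl w \<noteq> []" "last w = last (tl w)"
        using normal_not_Nil[of "tl w"] w by (auto simp: normal_Ghost_iff last_tl)
      have "w' = tl w \<or> (\<exists>\<eta>\<in>out_arcs E (tail E \<alpha>) - {\<alpha>}.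
          i \<le> \<omega> \<eta> \<and> j \<le> \<omega> \<eta> \<and> w' = Edge \<eta> i # Ghost \<eta> j # tl w)"
        using w' unfolding Edge y
        by (auto simp: in_keys_iff lookup_minus lookup_sum lookup_single when_def
            split: if_splits elim!: sum.not_neutral_contains_not_neutral)
      moreover note \<open>tl w \<noteq> []\<close> \<open>last w = last (tl w)\<close>
      moreover have "\<not> forbidden (Ghost \<eta> j) (hd (tl w))" for \<eta>
        using n forbidden_Ghost_arc[of \<eta> j "hd (tl w)" \<alpha>] by (simp add: normal_Ghost_iff)
      ultimately show ?thesis
        using n \<alpha> assms(2) unfolding Edge
        by (auto simp: normal_Edge_iff normal_Ghost_iff Edge_in_X)
    next
      case (Ghost \<alpha> i)
      then obtain \<beta> where y: "hd w = Edge \<beta> 1" and i: "i = 1"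
        using forb by (cases "hd w") auto
      have n: "normal (Edge \<beta> 1 # tl w)" using assms(1) w y by simp
      then have "tl w \<noteq> []" "last w = last (tl w)"
        using normal_not_Nil[of "tl w"] w by (auto simp: normal_Edge_iff last_tl)
      have "\<alpha> = \<beta> \<and> w' = tl w \<or> (\<exists>k\<in>{2..min (\<omega> \<alpha>) (\<omega> \<beta>)}. w' = Ghost \<alpha> k # Edge \<beta> k # tl w)"
        using w' unfolding Ghost y
        by (auto simp: in_keys_iff lookup_minus lookup_sum lookup_single when_def
            split: if_splits elim!: sum.not_neutral_contains_not_neutral)
      moreover note \<open>tl w \<noteq> []\<close> \<open>last w = last (tl w)\<close>
      moreover have "\<not> forbidden (Edge \<beta> k) (hd (tl w))" for k
        using n forbidden_Edge_index[of \<beta> k "hd (tl w)" 1] by (simp add: normal_Edge_iff)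
      ultimately show ?thesis
        using n assms(2) rng y unfolding Ghost
        by (auto simp: normal_Edge_iff normal_Ghost_iff Ghost_in_X)
    qed
  qed
qed

definition normal_span :: "(('v, 'e) letter list \<Rightarrow>\<^sub>0 'r::ring_1) set" where
  "normal_span = {n. Poly_Mapping.keys n \<subseteq> Collect normal}"

lemma normal_span_wd: "normal w \<Longrightarrow> wd w \<in> normal_span"
  by (simp add: normal_span_def)

lemma act_normal_span:
  fixes n :: "_ \<Rightarrow>\<^sub>0 'r::ring_1"
  assumes "n \<in> normal_span" "xs \<in> lists X"
  shows "act xs n \<in> normal_span"
  using assms(2)
proof (induction xs)
  case (Cons x xs)
  have "normal w'" if w': "w' \<in> Poly_Mapping.keys (act (x # xs) n)" for w'
  proof -
    obtain w where "w \<in> Poly_Mapping.keys (act xs n)" "w' \<in> Poly_Mapping.keys (act1 x w :: _ \<Rightarrow>\<^sub>0 'r)"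
      using w' keys_lin[of "act1 x" "act xs n"] by auto
    then show ?thesis using Cons keys_act1[of w x w'] by (auto simp: normal_span_def)
  qed
  then show ?case by (auto simp: normal_span_def)
qed (use assms in simp)

lemma apply_normal_span: "n \<in> normal_span \<Longrightarrow> f \<in> words X \<Longrightarrow> f \<star> n \<in> normal_span"
  using act_normal_span[of n] keys_lin[of "\<lambda>xs. act xs n" f]
  unfolding normal_span_def words_def apply_poly_def by fastforce


section \<open>The action satisfies the relations\<close>

text \<open>Only the summand of \<open>sp v\<close> is a reduction, and it contributes the
  right-hand side of relation (3) minus exactly the other summands, which act by prepending.\<close>

lemma reduction_sum_edge_ghost:
  assumes "v \<in> verts E" "\<not> sink E v" "i \<le> vertex_weight E \<omega> v" "j \<le> vertex_weight E \<omega> v"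
  shows "(\<Sum>\<alpha>\<in>out_arcs E v. if i \<le> \<omega> \<alpha> \<and> j \<le> \<omega> \<alpha> then act1 (Edge \<alpha> i) (Ghost \<alpha> j # w) else 0)
    = (if i = j then wd w else (0 :: _ \<Rightarrow>\<^sub>0 'r::ring_1))"
proof -
  let ?s = "sp v"
  have s: "?s \<in> out_arcs E v" "\<omega> ?s = vertex_weight E \<omega> v" "tail E ?s = v"
    using special[OF assms(1,2)] by auto
  have "(\<Sum>\<alpha>\<in>out_arcs E v - {?s}.
        if i \<le> \<omega> \<alpha> \<and> j \<le> \<omega> \<alpha> then act1 (Edge \<alpha> i) (Ghost \<alpha> j # w) else (0 :: _ \<Rightarrow>\<^sub>0 'r)) =
      (\<Sum>\<alpha>\<in>out_arcs E v - {?s}.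
        if i \<le> \<omega> \<alpha> \<and> j \<le> \<omega> \<alpha> then wd (Edge \<alpha> i # Ghost \<alpha> j # w) else 0)"
    by (intro sum.cong) (auto simp: act1_def)
  moreover have "act1 (Edge ?s i) (Ghost ?s j # w) = (if i = j then wd w else (0 :: _ \<Rightarrow>\<^sub>0 'r)) -
      (\<Sum>\<alpha>\<in>out_arcs E v - {?s}.
        if i \<le> \<omega> \<alpha> \<and> j \<le> \<omega> \<alpha> then wd (Edge \<alpha> i # Ghost \<alpha> j # w) else 0)"
    using s by (auto simp: act1_def)
  moreover have "i \<le> \<omega> ?s" "j \<le> \<omega> ?s"
    using assms s by simp_all
  ultimately show ?thesis
    by (simp only: sum.remove[OF row_finite[OF assms(1)] s(1)] if_True simp_thms diff_add_cancel)
qed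

text \<open>Only the summand \<open>i = 1\<close> is a reduction, and its correction terms cancel
  the summands from \<open>2\<close> on. The upper limit \<open>M\<close> is kept variable because
  the sum is met with different limits.\<close>

lemma reduction_sum_ghost_edge:
  assumes "\<alpha> \<in> arcs E" "\<beta> \<in> arcs E" "tail E \<alpha> = tail E \<beta>" "min (\<omega> \<alpha>) (\<omega> \<beta>) \<le> M"
  shows "(\<Sum>i=1..M. if i \<le> \<omega> \<alpha> \<and> i \<le> \<omega> \<beta> then act1 (Ghost \<alpha> i) (Edge \<beta> i # w) else 0)
    = (if \<alpha> = \<beta> then wd w else (0 :: _ \<Rightarrow>\<^sub>0 'r::ring_1))"
proof -
  let ?m = "min (\<omega> \<alpha>) (\<omega> \<beta>)"
  have m: "{1..?m} = insert 1 {2..?m}"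
    using weight_pos[OF assms(1)] weight_pos[OF assms(2)] by auto
  have "(\<Sum>i=1..M. if i \<le> \<omega> \<alpha> \<and> i \<le> \<omega> \<beta> then act1 (Ghost \<alpha> i) (Edge \<beta> i # w) else (0 :: _ \<Rightarrow>\<^sub>0 'r))
      = (\<Sum>i=1..?m. act1 (Ghost \<alpha> i) (Edge \<beta> i # w))"
    using assms(4) by (intro sum.mono_neutral_cong_right) auto
  also have "\<dots> = act1 (Ghost \<alpha> 1) (Edge \<beta> 1 # w) + (\<Sum>i=2..?m. act1 (Ghost \<alpha> i) (Edge \<beta> i # w))"
    unfolding m by simp
  also have "(\<Sum>i=2..?m. act1 (Ghost \<alpha> i) (Edge \<beta> i # w)) =
      (\<Sum>i=2..?m. wd (Ghost \<alpha> i # Edge \<beta> i # w) :: _ \<Rightarrow>\<^sub>0 'r)"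
    using assms(3) by (intro sum.cong) (auto simp: act1_def)
  finally show ?thesis using assms(3) by (auto simp: act1_def)
qed

text \<open>The essential case is the overlap
  \<open>\<alpha>\<^sub>i \<alpha>\<^sub>1\<^sup>* \<gamma>\<^sub>1\<close>: the right pair is
  reduced first, the sums are exchanged, and relation (3) is applied again to the inner sums over
  \<open>\<alpha>\<close>.\<close>

lemma act_relation_edge_ghost:
  assumes "v \<in> verts E" "\<not> sink E v" "normal w"
    and ij: "i \<in> {1..vertex_weight E \<omega> v}" "j \<in> {1..vertex_weight E \<omega> v}"
  shows "(\<Sum>\<alpha>\<in>out_arcs E v.
      if i \<le> \<omega> \<alpha> \<and> j \<le> \<omega> \<alpha> then lin (act1 (Edge \<alpha> i)) (act1 (Ghost \<alpha> j) w) else 0)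
    = (if i = j \<and> v = src (hd w) then wd w else (0 :: _ \<Rightarrow>\<^sub>0 'r::ring_1))"
proof (cases "v = src (hd w)")
  case False
  then show ?thesis by (auto simp: act1_def intro!: sum.neutral)
next
  case True
  note red = reduction_sum_edge_ghost[OF assms(1,2)]
  show ?thesis
  \<comment> \<open>Whether a ghost is forbidden in front of a letter depends on its index but not
    on its arc, so \<open>sp v\<close> stands for all arcs leaving \<open>v\<close>.\<close>
  proof (cases "forbidden (Ghost (sp v) j) (hd w)")
    case False
    then have "lin (act1 (Edge \<alpha> i)) (act1 (Ghost \<alpha> j) w) =
        (act1 (Edge \<alpha> i) (Ghost \<alpha> j # w) :: _ \<Rightarrow>\<^sub>0 'r)"
      if "\<alpha> \<in> out_arcs E v" for \<alpha>
      using that True forbidden_Ghost_arc[of \<alpha> j "hd w" "sp v"] by (auto simp: act1_def[of "Ghost \<alpha> j"])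
    then show ?thesis
      using red[of i j w] ij True by (simp cong: if_cong)
  next
    case forb: True
    then obtain \<gamma> w' where w: "w = Edge \<gamma> 1 # w'" and j: "j = 1"
      using normal_not_Nil[OF assms(3)] by (cases w; cases "hd w") auto
    have \<gamma>: "normal w'" "\<gamma> \<in> arcs E" "tail E \<gamma> = v" "head E \<gamma> = src (hd w')"
        "\<And>k. \<not> forbidden (Edge \<gamma> k) (hd w')"
      using assms(3) True forbidden_Edge_index[of \<gamma> _ "hd w'" 1] unfolding w by (auto simp: normal_Edge_iff)
    let ?A = "\<lambda>\<alpha> k. act1 (Edge \<alpha> i) (Ghost \<alpha> k # Edge \<gamma> k # w') :: _ \<Rightarrow>\<^sub>0 'r"
    have "(if i \<le> \<omega> \<alpha> \<and> j \<le> \<omega> \<alpha> then lin (act1 (Edge \<alpha> i)) (act1 (Ghost \<alpha> j) w) else 0) =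
        (if \<gamma> = \<alpha> then if i \<le> \<omega> \<alpha> then wd (Edge \<gamma> i # w') else 0 else 0) -
        (\<Sum>k=2..\<omega> \<gamma>. if i \<le> \<omega> \<alpha> \<and> k \<le> \<omega> \<alpha> then ?A \<alpha> k else 0)"
      if \<alpha>: "\<alpha> \<in> out_arcs E v" for \<alpha>
    proof (cases "i \<le> \<omega> \<alpha>")
      case True
      \<comment> \<open>With the limit \<open>\<omega> \<gamma>\<close> and a guard in place of the
        minimum, the range of \<open>k\<close> no longer depends on \<open>\<alpha>\<close> and the
        sums can be exchanged.\<close>
      have "(\<Sum>k=2..min (\<omega> \<alpha>) (\<omega> \<gamma>). ?A \<alpha> k) = (\<Sum>k=2..\<omega> \<gamma>. if k \<le> \<omega> \<alpha> then ?A \<alpha> k else 0)"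
        by (intro sum.mono_neutral_cong_left) auto
      moreover have "act1 (Ghost \<alpha> 1) (Edge \<gamma> 1 # w') = (if \<alpha> = \<gamma> then wd w' else 0) -
          (\<Sum>k=2..min (\<omega> \<alpha>) (\<omega> \<gamma>). wd (Ghost \<alpha> k # Edge \<gamma> k # w') :: _ \<Rightarrow>\<^sub>0 'r)"
        using \<alpha> \<gamma> by (simp add: act1_def)
      moreover have "act1 (Edge \<gamma> i) w' = (wd (Edge \<gamma> i # w') :: _ \<Rightarrow>\<^sub>0 'r)"
        using \<gamma> by (auto simp: act1_def)
      moreover have "j \<le> \<omega> \<alpha>"
        using \<alpha> weight_pos[of \<alpha>] j by simp
      ultimately show ?thesis
        using True unfolding j w by (auto simp del: One_nat_def simp: lin_diff lin_sum)
    qed simp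
    then have "(\<Sum>\<alpha>\<in>out_arcs E v.
          if i \<le> \<omega> \<alpha> \<and> j \<le> \<omega> \<alpha> then lin (act1 (Edge \<alpha> i)) (act1 (Ghost \<alpha> j) w) else 0)
        = (\<Sum>\<alpha>\<in>out_arcs E v. if \<gamma> = \<alpha> then if i \<le> \<omega> \<alpha> then wd (Edge \<gamma> i # w') else 0 else 0) -
          (\<Sum>\<alpha>\<in>out_arcs E v. \<Sum>k=2..\<omega> \<gamma>. if i \<le> \<omega> \<alpha> \<and> k \<le> \<omega> \<alpha> then ?A \<alpha> k else 0)"
      by (simp add: sum_subtractf)
    also have "(\<Sum>\<alpha>\<in>out_arcs E v. if \<gamma> = \<alpha> then if i \<le> \<omega> \<alpha> then wd (Edge \<gamma> i # w') else 0 else (0 :: _ \<Rightarrow>\<^sub>0 'r))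
        = (if i \<le> \<omega> \<gamma> then wd (Edge \<gamma> i # w') else 0)"
      using \<gamma> row_finite[OF assms(1)] by (subst sum.delta') auto
    also have "(\<Sum>\<alpha>\<in>out_arcs E v. \<Sum>k=2..\<omega> \<gamma>. if i \<le> \<omega> \<alpha> \<and> k \<le> \<omega> \<alpha> then ?A \<alpha> k else 0)
        = (\<Sum>k=2..\<omega> \<gamma>. \<Sum>\<alpha>\<in>out_arcs E v. if i \<le> \<omega> \<alpha> \<and> k \<le> \<omega> \<alpha> then ?A \<alpha> k else 0)"
      by (rule sum.swap)
    also have "\<dots> = (\<Sum>k=2..\<omega> \<gamma>. if i = k then wd (Edge \<gamma> k # w') else (0 :: _ \<Rightarrow>\<^sub>0 'r))"
      using ij weight_le_vertex_weight[OF \<gamma>(2)] \<gamma>(3) by (intro sum.cong red) auto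
    also have "\<dots> = (if i \<in> {2..\<omega> \<gamma>} then wd (Edge \<gamma> i # w') else 0)"
      by (subst sum.delta') auto
    \<comment> \<open>For \<open>i \<ge> 2\<close> the two terms cancel or are both
      \<open>0\<close>; for \<open>i = 1\<close> only the first remains, and it is
      \<open>w\<close>.\<close>
    finally show ?thesis using ij True weight_pos[OF \<gamma>(2)] unfolding j w by auto
  qed
qed

text \<open>The essential case is the mirror overlap \<open>\<alpha>\<^sub>i\<^sup>* \<beta>\<^sub>i
  \<beta>\<^sub>j\<^sup>*\<close> with \<open>\<beta>\<close> special. Again the right pair is
  reduced first; the inner sums over \<open>i\<close> then collapse by relation (4).\<close>

lemma act_relation_ghost_edge:
  assumes "\<alpha> \<in> arcs E" "\<beta> \<in> arcs E" "normal w"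
  shows "(\<Sum>i=1..max (\<omega> \<alpha>) (\<omega> \<beta>).
      if i \<le> \<omega> \<alpha> \<and> i \<le> \<omega> \<beta> then lin (act1 (Ghost \<alpha> i)) (act1 (Edge \<beta> i) w) else 0)
    = (if \<alpha> = \<beta> \<and> head E \<alpha> = src (hd w) then wd w else (0 :: _ \<Rightarrow>\<^sub>0 'r::ring_1))"
proof -
  consider (range) "head E \<beta> \<noteq> src (hd w)"
    | (tail) "tail E \<alpha> \<noteq> tail E \<beta>"
    | (free) "head E \<beta> = src (hd w)" "tail E \<alpha> = tail E \<beta>" "\<not> forbidden (Edge \<beta> 1) (hd w)"
    | (forb) "head E \<beta> = src (hd w)" "tail E \<alpha> = tail E \<beta>" "forbidden (Edge \<beta> 1) (hd w)"
    by blast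
  then show ?thesis
  proof cases
    case range
    then show ?thesis by (auto simp: act1_def intro!: sum.neutral)
  next
    case tail
    \<comment> \<open>Every word produced by \<open>\<beta>\<^sub>i\<close> starts at the tail of
      \<open>\<beta>\<close>, which is not where \<open>\<alpha>\<^sub>i\<^sup>*\<close>
      ends.\<close>
    have "lin (act1 (Ghost \<alpha> i)) (act1 (Edge \<beta> i) w) = (0 :: _ \<Rightarrow>\<^sub>0 'r)"
      if "1 \<le> i" "i \<le> \<omega> \<beta>" for i
    proof -
      have "lin (act1 (Ghost \<alpha> i)) (act1 (Edge \<beta> i) w) = lin (\<lambda>_. 0) (act1 (Edge \<beta> i) w :: _ \<Rightarrow>\<^sub>0 'r)"
      proof (rule lin_cong)
        fix w'
        assume w': "w' \<in> Poly_Mapping.keys (act1 (Edge \<beta> i) w :: _ \<Rightarrow>\<^sub>0 'r)"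
        have "src (hd w') = tail E \<beta>"
          using keys_act1[OF assms(3) _ w'] that assms(2) by (simp add: Edge_in_X)
        then show "act1 (Ghost \<alpha> i) w' = (0 :: _ \<Rightarrow>\<^sub>0 'r)" using tail by (simp add: act1_def)
      qed
      then show ?thesis by (simp add: poly_mapping_eq_iff fun_eq_iff lookup_lin)
    qed
    then show ?thesis using tail by (auto intro!: sum.neutral)
  next
    case free
    then have "lin (act1 (Ghost \<alpha> i)) (act1 (Edge \<beta> i) w) =
        (act1 (Ghost \<alpha> i) (Edge \<beta> i # w) :: _ \<Rightarrow>\<^sub>0 'r)" for i
      using forbidden_Edge_index[of \<beta> i "hd w" 1] by (auto simp: act1_def[of "Edge \<beta> i"])
    moreover have "min (\<omega> \<alpha>) (\<omega> \<beta>) \<le> max (\<omega> \<alpha>) (\<omega> \<beta>)"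
      by simp
    ultimately show ?thesis
      using free(1) by (simp only: reduction_sum_ghost_edge[OF assms(1,2) free(2)]) auto
  next
    case forb
    then obtain j w' where w: "w = Ghost \<beta> j # w'" and \<beta>: "\<beta> = sp (tail E \<beta>)"
      using normal_not_Nil[OF assms(3)] by (cases w; cases "hd w") auto
    have w': "normal w'" "1 \<le> j" "j \<le> \<omega> \<beta>" "tail E \<beta> = src (hd w')"
        "\<not> forbidden (Ghost \<beta> j) (hd w')"
      using assms(3) unfolding w by (auto simp: normal_Ghost_iff)
    \<comment> \<open>Being special, \<open>\<beta>\<close> has the largest weight at its tail.
      Hence the outer range is \<open>1..\<omega> \<beta>\<close>, which is long enough for every
      inner sum.\<close>
    have le: "\<omega> \<eta> \<le> \<omega> \<beta>" if "\<eta> \<in> arcs E" "tail E \<eta> = tail E \<beta>" for \<eta>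
      using weight_le_special[OF that(1)] that(2) \<beta> by simp
    then have max: "max (\<omega> \<alpha>) (\<omega> \<beta>) = \<omega> \<beta>" using assms(1) forb(2) by auto
    let ?O = "out_arcs E (tail E \<beta>) - {\<beta>}"
    let ?A = "\<lambda>\<eta> i. act1 (Ghost \<alpha> i) (Edge \<eta> i # Ghost \<eta> j # w') :: _ \<Rightarrow>\<^sub>0 'r"
    have fin: "finite ?O" using row_finite assms(2) by simp
    have free: "act1 (Ghost \<alpha> j) w' = (wd (Ghost \<alpha> j # w') :: _ \<Rightarrow>\<^sub>0 'r)"
      using w' forb(2) forbidden_Ghost_arc[of \<alpha> j "hd w'" \<beta>] by (auto simp: act1_def)
    have "(if i \<le> \<omega> \<alpha> \<and> i \<le> \<omega> \<beta> then lin (act1 (Ghost \<alpha> i)) (act1 (Edge \<beta> i) w) else 0) =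
        (if i = j then if j \<le> \<omega> \<alpha> then wd (Ghost \<alpha> j # w') else 0 else 0) -
        (\<Sum>\<eta>\<in>?O. if j \<le> \<omega> \<eta> then if i \<le> \<omega> \<alpha> \<and> i \<le> \<omega> \<eta> then ?A \<eta> i else 0 else 0)"
      if "i \<in> {1..\<omega> \<beta>}" for i
    proof (cases "i \<le> \<omega> \<alpha>")
      case True
      have "lin (act1 (Ghost \<alpha> i)) (act1 (Edge \<beta> i) w) =
          (if i = j then act1 (Ghost \<alpha> j) w' else 0) -
          (\<Sum>\<eta>\<in>?O. if i \<le> \<omega> \<eta> \<and> j \<le> \<omega> \<eta> then ?A \<eta> i else 0)"
        using forb(1) \<beta> unfolding w 
        by (simp add: act1_def[of "Edge \<beta> i"] lin_diff lin_uminus lin_sum lin_if cong: if_cong)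
      also have "(\<Sum>\<eta>\<in>?O. if i \<le> \<omega> \<eta> \<and> j \<le> \<omega> \<eta> then ?A \<eta> i else 0) =
          (\<Sum>\<eta>\<in>?O. if j \<le> \<omega> \<eta> then if i \<le> \<omega> \<alpha> \<and> i \<le> \<omega> \<eta> then ?A \<eta> i else 0 else 0)"
        using True by (intro sum.cong) auto
      finally show ?thesis using True that free by auto
    next
      case False
      then show ?thesis by (auto cong: if_cong)
    qed
    then have "(\<Sum>i=1..\<omega> \<beta>. if i \<le> \<omega> \<alpha> \<and> i \<le> \<omega> \<beta> then lin (act1 (Ghost \<alpha> i)) (act1 (Edge \<beta> i) w) else 0)
        = (\<Sum>i=1..\<omega> \<beta>. if i = j then if j \<le> \<omega> \<alpha> then wd (Ghost \<alpha> j # w') else 0 else 0) -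
          (\<Sum>i=1..\<omega> \<beta>. \<Sum>\<eta>\<in>?O. if j \<le> \<omega> \<eta> then if i \<le> \<omega> \<alpha> \<and> i \<le> \<omega> \<eta> then ?A \<eta> i else 0 else 0)"
      by (simp add: sum_subtractf)
    also have "(\<Sum>i=1..\<omega> \<beta>. if i = j then if j \<le> \<omega> \<alpha> then wd (Ghost \<alpha> j # w') else 0 else (0 :: _ \<Rightarrow>\<^sub>0 'r))
        = (if j \<le> \<omega> \<alpha> then wd (Ghost \<alpha> j # w') else 0)"
      using w' by (subst sum.delta) auto
    also have "(\<Sum>i=1..\<omega> \<beta>. \<Sum>\<eta>\<in>?O. if j \<le> \<omega> \<eta> then if i \<le> \<omega> \<alpha> \<and> i \<le> \<omega> \<eta> then ?A \<eta> i else 0 else 0)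
        = (\<Sum>\<eta>\<in>?O. if j \<le> \<omega> \<eta> then \<Sum>i=1..\<omega> \<beta>. if i \<le> \<omega> \<alpha> \<and> i \<le> \<omega> \<eta> then ?A \<eta> i else 0 else 0)"
      by (subst sum.swap) (intro sum.cong, auto)
    also have "\<dots> = (\<Sum>\<eta>\<in>?O. if \<alpha> = \<eta> then if j \<le> \<omega> \<alpha> then wd (Ghost \<alpha> j # w') else 0 else 0)"
    proof (intro sum.cong refl)
      fix \<eta>
      assume \<eta>: "\<eta> \<in> ?O"
      then have "(\<Sum>i=1..\<omega> \<beta>. if i \<le> \<omega> \<alpha> \<and> i \<le> \<omega> \<eta> then ?A \<eta> i else 0)
          = (if \<alpha> = \<eta> then wd (Ghost \<eta> j # w') else 0)"
        using forb(2) le[of \<eta>] assms(1) by (intro reduction_sum_ghost_edge) auto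
      then show "(if j \<le> \<omega> \<eta> then \<Sum>i=1..\<omega> \<beta>. if i \<le> \<omega> \<alpha> \<and> i \<le> \<omega> \<eta> then ?A \<eta> i else 0 else 0)
          = (if \<alpha> = \<eta> then if j \<le> \<omega> \<alpha> then wd (Ghost \<alpha> j # w') else 0 else 0)"
        by auto
    qed
    also have "\<dots> = (if \<alpha> \<in> ?O then if j \<le> \<omega> \<alpha> then wd (Ghost \<alpha> j # w') else 0 else 0)"
      using fin by (subst sum.delta') auto
    \<comment> \<open>If \<open>\<alpha> = \<beta>\<close>, the subtracted term is absent and the
      first is \<open>w\<close>; otherwise \<open>\<alpha>\<close> is among the other arcs and the
      two terms cancel.\<close>
    finally show ?thesis unfolding max using assms(1) forb(1,2) w'(3) unfolding w by auto
  qed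
qed

end

section \<open>From the single relations to the ideal they generate\<close>

lemma edge_ghost_mult:
  "word_mult (edge_elt \<omega> \<alpha> i) (ghost_elt \<omega> \<beta> j) =
     (if i \<le> \<omega> \<alpha> \<and> j \<le> \<omega> \<beta> then wd [Edge \<alpha> i, Ghost \<beta> j] else 0)"
  by (simp add: edge_elt_def ghost_elt_def)

lemma ghost_edge_mult:
  "word_mult (ghost_elt \<omega> \<alpha> i) (edge_elt \<omega> \<beta> j) =
     (if i \<le> \<omega> \<alpha> \<and> j \<le> \<omega> \<beta> then wd [Ghost \<alpha> i, Edge \<beta> j] else 0)"
  by (simp add: edge_elt_def ghost_elt_def)

context special_arcs
begin

text \<open>Brings the relations into a uniform shape: the four families of (2) become two through
  sources and ranges, and generators that are \<open>0\<close> beyond their weight become guards in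
  the sums.\<close>

lemma relation_cases [consumes 1, case_names vertices source range edge_ghost ghost_edge]:
  fixes f :: "('v, 'e) letter list \<Rightarrow>\<^sub>0 'r::ring_1"
  assumes "f \<in> wlpa_relations E \<omega>"
  obtains v w where "v \<in> verts E" "w \<in> verts E"
      "f = wd [Vertex v, Vertex w] - (if v = w then wd [Vertex v] else 0)"
    | x where "x \<in> X" "f = wd [Vertex (src x), x] - wd [x]"
    | x where "x \<in> X" "f = wd [x, Vertex (rng x)] - wd [x]"
    | v i j where "v \<in> verts E" "\<not> sink E v"
      "i \<in> {1..vertex_weight E \<omega> v}" "j \<in> {1..vertex_weight E \<omega> v}"
      "f = (\<Sum>\<alpha>\<in>out_arcs E v. if i \<le> \<omega> \<alpha> \<and> j \<le> \<omega> \<alpha> then wd [Edge \<alpha> i, Ghost \<alpha> j] else 0)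
        - (if i = j then wd [Vertex v] else 0)"
    | \<alpha> \<beta> where "\<alpha> \<in> arcs E" "\<beta> \<in> arcs E"
      "f = (\<Sum>i=1..max (\<omega> \<alpha>) (\<omega> \<beta>). if i \<le> \<omega> \<alpha> \<and> i \<le> \<omega> \<beta> then wd [Ghost \<alpha> i, Edge \<beta> i] else 0)
        - (if \<alpha> = \<beta> then wd [Vertex (head E \<alpha>)] else 0)"
proof -
  consider (1) "f \<in> {word_mult (vertex_elt v) (vertex_elt w) - (if v = w then vertex_elt v else 0) | v w.
        v \<in> verts E \<and> w \<in> verts E}"
    | (2) \<alpha> i where "\<alpha> \<in> arcs E" "i \<in> {1..\<omega> \<alpha>}"
      "f \<in> {word_mult (vertex_elt (tail E \<alpha>)) (edge_elt \<omega> \<alpha> i) - edge_elt \<omega> \<alpha> i,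
         word_mult (edge_elt \<omega> \<alpha> i) (vertex_elt (head E \<alpha>)) - edge_elt \<omega> \<alpha> i,
         word_mult (vertex_elt (head E \<alpha>)) (ghost_elt \<omega> \<alpha> i) - ghost_elt \<omega> \<alpha> i,
         word_mult (ghost_elt \<omega> \<alpha> i) (vertex_elt (tail E \<alpha>)) - ghost_elt \<omega> \<alpha> i}"
    | (3) "f \<in> {(\<Sum>\<alpha>\<in>out_arcs E v. word_mult (edge_elt \<omega> \<alpha> i) (ghost_elt \<omega> \<alpha> j))
        - (if i = j then vertex_elt v else 0) | v i j.
        v \<in> verts E \<and> \<not> sink E v \<and>
        i \<in> {1..vertex_weight E \<omega> v} \<and> j \<in> {1..vertex_weight E \<omega> v}}"
    | (4) "f \<in> {(\<Sum>i=1..max (\<omega> \<alpha>) (\<omega> \<beta>). word_mult (ghost_elt \<omega> \<alpha> i) (edge_elt \<omega> \<beta> i))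
        - (if \<alpha> = \<beta> then vertex_elt (head E \<alpha>) else 0) | \<alpha> \<beta>.
        \<alpha> \<in> arcs E \<and> \<beta> \<in> arcs E}"
    using assms unfolding wlpa_relations_def by blast
  then show thesis
  proof cases
    case 1
    then obtain v w where "v \<in> verts E" "w \<in> verts E"
      "f = word_mult (vertex_elt v) (vertex_elt w) - (if v = w then vertex_elt v else 0)" by blast
    then show thesis by (intro that(1)[of v w]) (simp_all add: vertex_elt_def)
  next
    case 2
    then have "f = wd [Vertex (src (Edge \<alpha> i)), Edge \<alpha> i] - wd [Edge \<alpha> i] \<or>
        f = wd [Edge \<alpha> i, Vertex (rng (Edge \<alpha> i))] - wd [Edge \<alpha> i] \<or>
        f = wd [Vertex (src (Ghost \<alpha> i)), Ghost \<alpha> i] - wd [Ghost \<alpha> i] \<or>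
        f = wd [Ghost \<alpha> i, Vertex (rng (Ghost \<alpha> i))] - wd [Ghost \<alpha> i]"
      by (auto simp: vertex_elt_def edge_elt_def ghost_elt_def)
    moreover have "Edge \<alpha> i \<in> X" "Ghost \<alpha> i \<in> X"
      using 2 by (simp_all add: Edge_in_X Ghost_in_X)
    ultimately show thesis using that(2,3) by blast
  next
    case 3
    then obtain v i j where "v \<in> verts E" "\<not> sink E v"
      "i \<in> {1..vertex_weight E \<omega> v}" "j \<in> {1..vertex_weight E \<omega> v}"
      "f = (\<Sum>\<alpha>\<in>out_arcs E v. word_mult (edge_elt \<omega> \<alpha> i) (ghost_elt \<omega> \<alpha> j))
        - (if i = j then vertex_elt v else 0)" by blast
    then show thesis by (intro that(4)[of v i j]) (simp_all add: edge_ghost_mult vertex_elt_def)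
  next
    case 4
    then obtain \<alpha> \<beta> where "\<alpha> \<in> arcs E" "\<beta> \<in> arcs E"
      "f = (\<Sum>i=1..max (\<omega> \<alpha>) (\<omega> \<beta>). word_mult (ghost_elt \<omega> \<alpha> i) (edge_elt \<omega> \<beta> i))
        - (if \<alpha> = \<beta> then vertex_elt (head E \<alpha>) else 0)" by blast
    then show thesis by (intro that(5)[of \<alpha> \<beta>]) (simp_all add: ghost_edge_mult vertex_elt_def)
  qed
qed

lemma letter_relations:
  assumes "\<alpha> \<in> arcs E" "i \<in> {1..\<omega> \<alpha>}"
  shows "word_mult (vertex_elt (tail E \<alpha>)) (edge_elt \<omega> \<alpha> i) - edge_elt \<omega> \<alpha> i \<in> wlpa_relations E \<omega>"
    and "word_mult (edge_elt \<omega> \<alpha> i) (vertex_elt (head E \<alpha>)) - edge_elt \<omega> \<alpha> i \<in> wlpa_relations E \<omega>"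
    and "word_mult (vertex_elt (head E \<alpha>)) (ghost_elt \<omega> \<alpha> i) - ghost_elt \<omega> \<alpha> i \<in> wlpa_relations E \<omega>"
    and "word_mult (ghost_elt \<omega> \<alpha> i) (vertex_elt (tail E \<alpha>)) - ghost_elt \<omega> \<alpha> i \<in> wlpa_relations E \<omega>"
  unfolding wlpa_relations_def using assms
  by - (rule UnI1, rule UnI1, rule UnI2, rule UN_I[of \<alpha>], assumption, rule UN_I[of i], assumption, blast)+

lemma relations_subset_words: "wlpa_relations E \<omega> \<subseteq> (words X :: (_ \<Rightarrow>\<^sub>0 'r::ring_1) set)"
proof
  fix f :: "('v, 'e) letter list \<Rightarrow>\<^sub>0 'r"
  assume "f \<in> wlpa_relations E \<omega>"
  then show "f \<in> words X"
  proof (cases rule: relation_cases)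
    case (vertices v w)
    then show ?thesis by (auto intro!: words_diff words_single simp: Vertex_in_X)
  next
    case (source x)
    then show ?thesis by (auto intro!: words_diff words_single simp: Vertex_in_X src_in_verts)
  next
    case (range x)
    then show ?thesis by (auto intro!: words_diff words_single simp: Vertex_in_X rng_in_verts)
  next
    case (edge_ghost v i j)
    then show ?thesis
      by (auto intro!: words_diff words_sum words_single simp: Vertex_in_X Edge_in_X Ghost_in_X)
  next
    case (ghost_edge \<alpha> \<beta>)
    then show ?thesis
      by (auto intro!: words_diff words_sum words_single simp: Vertex_in_X Edge_in_X Ghost_in_X)
  qed
qed

text \<open>
  Since \<open>R\<close> need not be commutative, a general element of the free ring does not act \<open>R\<close>-linearly;
  the relations do, because their coefficients are integers.
\<close>

definition acts_linearly :: "(('v, 'e) letter list \<Rightarrow>\<^sub>0 'r::ring_1) \<Rightarrow> bool" where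
  "acts_linearly f \<longleftrightarrow> (\<forall>n. f \<star> n = lin (\<lambda>w. f \<star> wd w) n)"

lemma acts_linearly_wd: "acts_linearly (wd xs)"
  unfolding acts_linearly_def apply_wd using act_eq_lin by blast

lemma acts_linearly_zero: "acts_linearly 0"
  by (simp add: acts_linearly_def)

lemma acts_linearly_diff:
  assumes "acts_linearly f" "acts_linearly g"
  shows "acts_linearly (f - g)"
  unfolding acts_linearly_def apply_diff lin_diff_fun
  using assms unfolding acts_linearly_def by metis

lemma acts_linearly_sum:
  assumes "\<And>i. i \<in> A \<Longrightarrow> acts_linearly (f i)"
  shows "acts_linearly (\<Sum>i\<in>A. f i)"
  unfolding acts_linearly_def apply_sum lin_sum_fun
  using assms unfolding acts_linearly_def by (metis (no_types, lifting) sum.cong)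

lemma acts_linearly_relation:
  assumes "f \<in> wlpa_relations E \<omega>"
  shows "acts_linearly f"
  using assms
  by (cases rule: relation_cases)
    (auto intro!: acts_linearly_diff acts_linearly_sum acts_linearly_wd acts_linearly_zero)

lemma apply_relation_wd:
  fixes f :: "('v, 'e) letter list \<Rightarrow>\<^sub>0 'r::ring_1"
  assumes "f \<in> wlpa_relations E \<omega>" "normal w"
  shows "f \<star> wd w = 0"
  using assms(1)
proof (cases rule: relation_cases)
  case (vertices u v)
  then show ?thesis by (auto simp: apply_diff apply_wd act1_def)
next
  case (source x)
  \<comment> \<open>All words in \<open>act1 x w\<close> start at the source of \<open>x\<close>,
    where this vertex acts as the identity.\<close>
  have "lin (act1 (Vertex (src x))) (act1 x w) = lin (\<lambda>w'. wd w') (act1 x w :: _ \<Rightarrow>\<^sub>0 'r)"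
  proof (rule lin_cong)
    fix w'
    assume w': "w' \<in> Poly_Mapping.keys (act1 x w :: _ \<Rightarrow>\<^sub>0 'r)"
    show "act1 (Vertex (src x)) w' = (wd w' :: _ \<Rightarrow>\<^sub>0 'r)"
      using keys_act1[OF assms(2) source(1) w'] by (simp add: act1_def)
  qed
  then show ?thesis unfolding source(2) by (simp add: apply_diff apply_wd)
next
  case (range x)
  then show ?thesis by (auto simp: apply_diff apply_wd act1_def)
next
  case (edge_ghost v i j)
  have "(if i \<le> \<omega> \<alpha> \<and> j \<le> \<omega> \<alpha> then wd [Edge \<alpha> i, Ghost \<alpha> j] else 0) \<star> wd w =
      (if i \<le> \<omega> \<alpha> \<and> j \<le> \<omega> \<alpha> then lin (act1 (Edge \<alpha> i)) (act1 (Ghost \<alpha> j) w) else (0 :: _ \<Rightarrow>\<^sub>0 'r))" for \<alpha>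
    by (simp add: apply_wd)
  then show ?thesis
    unfolding edge_ghost(5) apply_diff apply_sum
    by (simp only: act_relation_edge_ghost[OF edge_ghost(1,2) assms(2) edge_ghost(3,4)])
      (auto simp: apply_wd act1_def)
next
  case (ghost_edge \<alpha> \<beta>)
  have "(if i \<le> \<omega> \<alpha> \<and> i \<le> \<omega> \<beta> then wd [Ghost \<alpha> i, Edge \<beta> i] else 0) \<star> wd w =
      (if i \<le> \<omega> \<alpha> \<and> i \<le> \<omega> \<beta> then lin (act1 (Ghost \<alpha> i)) (act1 (Edge \<beta> i) w) else (0 :: _ \<Rightarrow>\<^sub>0 'r))" for i
    by (simp add: apply_wd)
  then show ?thesis
    unfolding ghost_edge(3) apply_diff apply_sum
    by (simp only: act_relation_ghost_edge[OF ghost_edge(1,2) assms(2)])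
      (auto simp: apply_wd act1_def)
qed

lemma apply_relation:
  fixes f :: "('v, 'e) letter list \<Rightarrow>\<^sub>0 'r::ring_1"
  assumes "f \<in> wlpa_relations E \<omega>" "n \<in> normal_span"
  shows "f \<star> n = 0"
proof -
  have "f \<star> n = lin (\<lambda>w. f \<star> wd w) n"
    using acts_linearly_relation[OF assms(1)] unfolding acts_linearly_def by blast
  also have "\<dots> = lin (\<lambda>_. 0) n"
    using assms by (intro lin_cong apply_relation_wd) (auto simp: normal_span_def)
  finally show ?thesis by simp
qed

text \<open>As an ideal containing the relations, the annihilator contains all that they generate;
  thus the algebra acts on the span of the normal words. Closure under right multiples rests on the
  stability of that span.\<close>

lemma words_ideal_annihilator:
  "words_ideal X {f \<in> words X. \<forall>n\<in>normal_span. f \<star> n = (0 :: _ \<Rightarrow>\<^sub>0 'r::ring_1)}"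
proof
  have "g \<star> 0 = 0" for g :: "('v, 'e) letter list \<Rightarrow>\<^sub>0 'r"
  proof -
    have "act xs 0 = (0 :: _ \<Rightarrow>\<^sub>0 'r)" for xs by (induction xs) simp_all
    then show ?thesis by (simp add: apply_poly_def)
  qed
  then show "rng_ideal {f \<in> words X. \<forall>n\<in>normal_span. f \<star> n = (0 :: _ \<Rightarrow>\<^sub>0 'r)} (free_rng X)"
    unfolding rng_ideal_free_rng_iff
    by (auto simp: words_add words_uminus words_mult apply_add apply_uminus apply_mult
        apply_normal_span)
next
  fix r and f :: "('v, 'e) letter list \<Rightarrow>\<^sub>0 'r"
  assume "f \<in> {f \<in> words X. \<forall>n\<in>normal_span. f \<star> n = 0}"
  moreover have "scal r 0 = (0 :: ('v, 'e) letter list \<Rightarrow>\<^sub>0 'r)"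
    by (rule poly_mapping_eqI) simp
  ultimately show "scal r f \<in> {f \<in> words X. \<forall>n\<in>normal_span. f \<star> n = 0}"
    by (simp add: words_scal apply_scal)
qed

text \<open>If nothing is forbidden in front of the first letter of \<open>q\<close>, no reduction
  occurs where the words meet, and \<open>p\<close> acts by prepending its letters. Its final vertex
  acts as the identity on \<open>q\<close>, hence \<open>butlast p\<close>.\<close>

lemma act_concat:
  assumes "normal p" "last p = Vertex t" "normal q" "src (hd q) = t" "\<And>x. \<not> forbidden x (hd q)"
  shows "act p (wd q) = (wd (butlast p @ q) :: _ \<Rightarrow>\<^sub>0 'r::ring_1) \<and> normal (butlast p @ q)"
  using assms(1,2)
proof (induction rule: normal.induct)
  case (normal_vertex v)
  then show ?case using assms by (simp add: act1_def)
next
  case (normal_Cons w x)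
  have w: "w \<noteq> []" using normal_not_Nil normal_Cons by blast
  have x: "x \<in> X" "x \<notin> range Vertex"
    using normal_Cons by (auto simp: edges_ghosts_eq[symmetric] generators_def edges_def ghost_edges_def)
  have hd: "src (hd (butlast w @ q)) = src (hd w)" "\<not> forbidden x (hd (butlast w @ q))"
  proof -
    \<comment> \<open>The next letter of \<open>p\<close> meets either the first letter of
      \<open>q\<close>, when only the final vertex of \<open>p\<close> was left, or the letter that
      it already preceded in \<open>p\<close>.\<close>
    have "hd (butlast w @ q) = hd q \<and> src (hd q) = src (hd w) \<or> hd (butlast w @ q) = hd w"
    proof (cases "butlast w")
      case Nil
      then have "w = [Vertex t]"
        using w append_butlast_last_id[OF w] normal_Cons.prems by simp
      then show ?thesis using assms by simp
    next
      case (Cons y ys)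
      then show ?thesis using append_butlast_last_id[OF w] by (metis append_Cons list.sel(1))
    qed
    then show "src (hd (butlast w @ q)) = src (hd w)" "\<not> forbidden x (hd (butlast w @ q))"
      using assms(5) normal_Cons by auto
  qed
  have IH: "act w (wd q) = (wd (butlast w @ q) :: _ \<Rightarrow>\<^sub>0 'r)" "normal (butlast w @ q)"
    using normal_Cons w by auto
  have "normal (x # butlast w @ q)"
    using normal_Cons IH hd x by (simp add: normal_Cons_iff)
  moreover have "act (x # w) (wd q) = (act1 x (butlast w @ q) :: _ \<Rightarrow>\<^sub>0 'r)"
    using IH(1) by simp
  moreover have "\<dots> = wd (x # butlast w @ q)"
    using hd x(2) normal_Cons.hyps by (simp add: act1_def)
  ultimately show ?case using w by simp
qed

end


section \<open>Normal forms in the weighted Leavitt path algebra\<close>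

locale wlpa = special_arcs E \<omega> sp + words_ideal "generators E \<omega>" I
  for E :: "('v, 'e) pre_digraph" and \<omega> sp
    and I :: "(('v, 'e) letter list \<Rightarrow>\<^sub>0 'r::ring_1) set" +
  assumes I_eq: "I = generated_ideal (generators E \<omega>) (wlpa_relations E \<omega>)"
begin

lemma relation_in_ideal: "f \<in> wlpa_relations E \<omega> \<Longrightarrow> f \<in> I"
  unfolding I_eq using generated_ideal_superset by blast

text \<open>The action factors through the algebra. This is the independence half of the normal
  form: elements that act differently are different.\<close>

lemma ideal_apply: "f \<in> I \<Longrightarrow> n \<in> normal_span \<Longrightarrow> f \<star> n = 0"
  using generated_ideal_minimal[OF words_ideal_annihilator, of "wlpa_relations E \<omega>"]
    relations_subset_words apply_relation
  unfolding I_eq by blast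

lemma cong_apply: "f \<approx> g \<Longrightarrow> n \<in> normal_span \<Longrightarrow> f \<star> n = g \<star> n"
  using ideal_apply[of "f - g" n] by (simp add: cong_def apply_diff)

section \<open>The relations as congruences, and reduction to normal form\<close>

lemma cong_vertices:
  assumes "v \<in> verts E" "w \<in> verts E"
  shows "wd [Vertex v, Vertex w] \<approx> (if v = w then wd [Vertex v] else 0)"
proof -
  have "word_mult (vertex_elt v) (vertex_elt w) - (if v = w then vertex_elt v else 0) \<in> I"
    by (rule relation_in_ideal, unfold wlpa_relations_def, rule UnI1, rule UnI1, rule UnI1)
      (use assms in blast)
  then show ?thesis unfolding cong_def vertex_elt_def word_mult_single by simp
qed

lemma cong_source_letter: "x \<in> X \<Longrightarrow> wd [Vertex (src x), x] \<approx> wd [x]"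
proof (cases x)
  case (Vertex v)
  assume "x \<in> X"
  then show ?thesis using cong_vertices[of v v] Vertex by (simp add: Vertex_in_X)
next
  case (Edge \<alpha> i)
  assume "x \<in> X"
  then have "word_mult (vertex_elt (tail E \<alpha>)) (edge_elt \<omega> \<alpha> i) - edge_elt \<omega> \<alpha> i \<in> I"
    using Edge by (intro relation_in_ideal letter_relations) (simp_all add: Edge_in_X)
  then show ?thesis using Edge \<open>x \<in> X\<close> by (simp add: cong_def Edge_in_X vertex_elt_def edge_elt_def)
next
  case (Ghost \<alpha> i)
  assume "x \<in> X"
  then have "word_mult (vertex_elt (head E \<alpha>)) (ghost_elt \<omega> \<alpha> i) - ghost_elt \<omega> \<alpha> i \<in> I"
    using Ghost by (intro relation_in_ideal letter_relations) (simp_all add: Ghost_in_X)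
  then show ?thesis using Ghost \<open>x \<in> X\<close> by (simp add: cong_def Ghost_in_X vertex_elt_def ghost_elt_def)
qed

lemma cong_range_letter: "x \<in> X \<Longrightarrow> wd [x, Vertex (rng x)] \<approx> wd [x]"
proof (cases x)
  case (Vertex v)
  assume "x \<in> X"
  then show ?thesis using cong_vertices[of v v] Vertex by (simp add: Vertex_in_X)
next
  case (Edge \<alpha> i)
  assume "x \<in> X"
  then have "word_mult (edge_elt \<omega> \<alpha> i) (vertex_elt (head E \<alpha>)) - edge_elt \<omega> \<alpha> i \<in> I"
    using Edge by (intro relation_in_ideal letter_relations) (simp_all add: Edge_in_X)
  then show ?thesis using Edge \<open>x \<in> X\<close> by (simp add: cong_def Edge_in_X vertex_elt_def edge_elt_def)
next
  case (Ghost \<alpha> i)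
  assume "x \<in> X"
  then have "word_mult (ghost_elt \<omega> \<alpha> i) (vertex_elt (tail E \<alpha>)) - ghost_elt \<omega> \<alpha> i \<in> I"
    using Ghost by (intro relation_in_ideal letter_relations) (simp_all add: Ghost_in_X)
  then show ?thesis using Ghost \<open>x \<in> X\<close> by (simp add: cong_def Ghost_in_X vertex_elt_def ghost_elt_def)
qed

lemma cong_edge_ghost:
  assumes "v \<in> verts E" "\<not> sink E v"
    "i \<in> {1..vertex_weight E \<omega> v}" "j \<in> {1..vertex_weight E \<omega> v}"
  shows "(\<Sum>\<alpha>\<in>out_arcs E v. if i \<le> \<omega> \<alpha> \<and> j \<le> \<omega> \<alpha> then wd [Edge \<alpha> i, Ghost \<alpha> j] else 0)
    \<approx> (if i = j then wd [Vertex v] else 0)"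
  unfolding cong_def edge_ghost_mult[symmetric] vertex_elt_def[symmetric]
  by (rule relation_in_ideal, unfold wlpa_relations_def, rule UnI1, rule UnI2) (use assms in blast)

lemma cong_ghost_edge:
  assumes "\<alpha> \<in> arcs E" "\<beta> \<in> arcs E"
  shows "(\<Sum>i=1..max (\<omega> \<alpha>) (\<omega> \<beta>). if i \<le> \<omega> \<alpha> \<and> i \<le> \<omega> \<beta> then wd [Ghost \<alpha> i, Edge \<beta> i] else 0)
    \<approx> (if \<alpha> = \<beta> then wd [Vertex (head E \<alpha>)] else 0)"
  unfolding cong_def ghost_edge_mult[symmetric] vertex_elt_def[symmetric]
  by (rule relation_in_ideal, unfold wlpa_relations_def, rule UnI2) (use assms in blast)

text \<open>A congruence may be used inside a longer word. An empty context is a case of its own, as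
  the free ring has no empty word to multiply by.\<close>

lemma cong_context:
  assumes "f \<approx> g" "u \<in> lists X" "w \<in> lists X"
  shows "lin (\<lambda>z. wd (u @ z @ w)) f \<approx> lin (\<lambda>z. wd (u @ z @ w)) g"
proof -
  have right: "lin (\<lambda>z. wd (z @ w)) f \<approx> lin (\<lambda>z. wd (z @ w)) g"
  proof (cases "w = []")
    case False
    then show ?thesis
      unfolding word_mult_single_right[symmetric]
      using assms by (intro cong_mult_right words_single) auto
  qed (use assms in simp)
  have "lin (\<lambda>z. wd (u @ z)) (lin (\<lambda>z. wd (z @ w)) f) \<approx> lin (\<lambda>z. wd (u @ z)) (lin (\<lambda>z. wd (z @ w)) g)"
  proof (cases "u = []")
    case False
    then show ?thesis
      unfolding word_mult_single_left[symmetric]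
      using assms right by (intro cong_mult_left words_single) auto
  qed (use right in simp)
  then show ?thesis by (simp add: lin_lin)
qed

lemma cong_source:
  assumes "w \<in> lists X" "w \<noteq> []"
  shows "wd (Vertex (src (hd w)) # w) \<approx> wd w"
  using cong_context[OF cong_source_letter[of "hd w"], of "[]" "tl w"] assms
  by (cases w) auto

text \<open>Inserting the range of \<open>x\<close> behind \<open>x\<close> and the source of
  \<open>w\<close> in front of \<open>w\<close> puts two distinct vertices next to each
  other.\<close>

lemma cong_mismatch:
  assumes "x \<in> X" "w \<in> lists X" "w \<noteq> []" "rng x \<noteq> src (hd w)"
  shows "wd (x # w) \<approx> 0"
proof -
  let ?a = "Vertex (rng x)" and ?b = "Vertex (src (hd w))"
  have hd: "hd w \<in> X" using assms by (cases w) auto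
  have b: "?b # w \<in> lists X" using assms hd by (simp add: Vertex_in_X src_in_verts)
  have "wd (x # w) \<approx> wd (x # ?b # w)"
    using cong_context[OF cong_source[OF assms(2,3)], of "[x]" "[]"] assms by (auto intro: cong_sym)
  also have "\<dots> \<approx> wd (x # ?a # ?b # w)"
    using cong_context[OF cong_range_letter[OF assms(1)], of "[]" "?b # w"] b by (auto intro: cong_sym)
  also have "\<dots> \<approx> 0"
    using cong_context[OF cong_vertices[of "rng x" "src (hd w)"], of "[x]" w] assms
      src_in_verts[OF hd] rng_in_verts[OF assms(1)] by auto
  finally show ?thesis .
qed

text \<open>The counterpart of \<open>ideal_apply\<close>: each clause of \<open>act1\<close>
  follows from the relations, so the action computes products in the algebra.\<close>

lemma cong_act1:
  assumes "normal w" "x \<in> X"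
  shows "wd (x # w) \<approx> act1 x w"
proof -
  have w: "w \<in> lists X" "w \<noteq> []" "w = hd w # tl w"
    using normal_lists normal_not_Nil assms by auto
  consider (mismatch) "rng x \<noteq> src (hd w)" | (vertex) "rng x = src (hd w)" "x \<in> range Vertex"
    | (free) "rng x = src (hd w)" "x \<notin> range Vertex" "\<not> forbidden x (hd w)"
    | (forb) "rng x = src (hd w)" "x \<notin> range Vertex" "forbidden x (hd w)"
    by blast
  then show ?thesis
  proof cases
    case mismatch
    then show ?thesis using cong_mismatch[OF assms(2) w(1,2)] by (simp add: act1_def)
  next
    case vertex
    then show ?thesis using cong_source[OF w(1,2)] by (auto simp: act1_def)
  next
    case free
    then show ?thesis by (simp add: act1_def)
  next
    case forb
    have act1: "act1 x w = (reduct x (hd w) (tl w) :: _ \<Rightarrow>\<^sub>0 'r)"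
      using forb by (simp add: act1_def)
    show ?thesis
    proof (cases x)
      case (Vertex v)
      then show ?thesis using forb by auto
    next
      case (Edge \<alpha> i)
      then obtain j where y: "hd w = Ghost \<alpha> j" and \<alpha>: "\<alpha> = sp (tail E \<alpha>)"
        using forb by (cases "hd w") auto
      define w' where "w' = tl w"
      have w_eq: "w = Ghost \<alpha> j # w'" using w(3) y by (simp add: w'_def)
      let ?v = "tail E \<alpha>"
      have n: "normal w'" "tail E \<alpha> = src (hd w')" "\<alpha> \<in> arcs E" "1 \<le> i" "i \<le> \<omega> \<alpha>" "1 \<le> j" "j \<le> \<omega> \<alpha>"
        using assms Edge unfolding w_eq by (auto simp: normal_Ghost_iff Edge_in_X)
      have w': "w' \<in> lists X" "w' \<noteq> []" using normal_lists normal_not_Nil n by auto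
      have \<omega>: "\<omega> \<alpha> \<le> vertex_weight E \<omega> ?v" by (rule weight_le_vertex_weight[OF n(3)])
      \<comment> \<open>Relation (3) at the tail of \<open>\<alpha>\<close>, multiplied by
        \<open>w'\<close> on the right. Its term for \<open>\<alpha>\<close> is
        \<open>x # w\<close>; moving the others across gives \<open>reduct\<close>.\<close>
      have "lin (\<lambda>z. wd ([] @ z @ w')) (\<Sum>\<eta>\<in>out_arcs E ?v. if i \<le> \<omega> \<eta> \<and> j \<le> \<omega> \<eta> then wd [Edge \<eta> i, Ghost \<eta> j] else 0)
          \<approx> lin (\<lambda>z. wd ([] @ z @ w')) (if i = j then wd [Vertex ?v] else 0)"
        using n(3-7) \<omega> w' not_sink_tail[OF n(3)] by (intro cong_context cong_edge_ghost) auto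
      then have "(\<Sum>\<eta>\<in>out_arcs E ?v. if i \<le> \<omega> \<eta> \<and> j \<le> \<omega> \<eta> then wd (Edge \<eta> i # Ghost \<eta> j # w') else 0)
          \<approx> (if i = j then wd (Vertex ?v # w') else 0)"
        by (simp add: lin_sum lin_if cong: if_cong)
      also have "(if i = j then wd (Vertex ?v # w') else 0) \<approx> (if i = j then wd w' else 0)"
        using cong_source[OF w'] n by simp
      finally have "(\<Sum>\<eta>\<in>out_arcs E ?v. if i \<le> \<omega> \<eta> \<and> j \<le> \<omega> \<eta> then wd (Edge \<eta> i # Ghost \<eta> j # w') else 0)
          \<approx> (if i = j then wd w' else 0)" .
      moreover have "(\<Sum>\<eta>\<in>out_arcs E ?v. if i \<le> \<omega> \<eta> \<and> j \<le> \<omega> \<eta> then wd (Edge \<eta> i # Ghost \<eta> j # w') else 0)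
          = wd (x # w) + (\<Sum>\<eta>\<in>out_arcs E ?v - {\<alpha>}.
             if i \<le> \<omega> \<eta> \<and> j \<le> \<omega> \<eta> then wd (Edge \<eta> i # Ghost \<eta> j # w') else (0 :: _ \<Rightarrow>\<^sub>0 'r))"
        using n(3-7) row_finite[OF tail_in_verts[OF n(3)]] by (subst sum.remove[of _ \<alpha>]) (auto simp: Edge w_eq)
      ultimately show ?thesis
        unfolding act1 unfolding y w'_def[symmetric] Edge reduct.simps
        by (simp add: cong_def algebra_simps)
    next
      case (Ghost \<alpha> i)
      then obtain \<beta> where y: "hd w = Edge \<beta> 1" and i: "i = 1"
        using forb by (cases "hd w") auto
      define w' where "w' = tl w"
      have w_eq: "w = Edge \<beta> 1 # w'" using w(3) y by (simp add: w'_def)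
      have n: "normal w'" "head E \<beta> = src (hd w')" "\<beta> \<in> arcs E" "\<alpha> \<in> arcs E"
        using assms Ghost unfolding w_eq by (auto simp: normal_Edge_iff Ghost_in_X)
      have w': "w' \<in> lists X" "w' \<noteq> []" using normal_lists normal_not_Nil n by auto
      let ?m = "min (\<omega> \<alpha>) (\<omega> \<beta>)" and ?M = "max (\<omega> \<alpha>) (\<omega> \<beta>)"
      \<comment> \<open>Relation (4) multiplied by \<open>w'\<close> on the right, to be solved for
        its term of index \<open>1\<close>.\<close>
      have "lin (\<lambda>z. wd ([] @ z @ w')) (\<Sum>k=1..?M. if k \<le> \<omega> \<alpha> \<and> k \<le> \<omega> \<beta> then wd [Ghost \<alpha> k, Edge \<beta> k] else 0)
          \<approx> lin (\<lambda>z. wd ([] @ z @ w')) (if \<alpha> = \<beta> then wd [Vertex (head E \<alpha>)] else 0)"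
        using n w' by (intro cong_context cong_ghost_edge) auto
      then have "(\<Sum>k=1..?M. if k \<le> \<omega> \<alpha> \<and> k \<le> \<omega> \<beta> then wd (Ghost \<alpha> k # Edge \<beta> k # w') else 0)
          \<approx> (if \<alpha> = \<beta> then wd (Vertex (head E \<alpha>) # w') else 0)"
        by (simp add: lin_sum lin_if cong: if_cong)
      also have "(if \<alpha> = \<beta> then wd (Vertex (head E \<alpha>) # w') else 0) \<approx> (if \<alpha> = \<beta> then wd w' else 0)"
        using cong_source[OF w'] n by simp
      finally have "(\<Sum>k=1..?M. if k \<le> \<omega> \<alpha> \<and> k \<le> \<omega> \<beta> then wd (Ghost \<alpha> k # Edge \<beta> k # w') else 0)
          \<approx> (if \<alpha> = \<beta> then wd w' else 0)" .
      moreover have "(\<Sum>k=1..?M. if k \<le> \<omega> \<alpha> \<and> k \<le> \<omega> \<beta> then wd (Ghost \<alpha> k # Edge \<beta> k # w') else 0)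
          = (\<Sum>k\<in>insert 1 {2..?m}. wd (Ghost \<alpha> k # Edge \<beta> k # w') :: _ \<Rightarrow>\<^sub>0 'r)"
        using weight_pos[OF n(3)] weight_pos[OF n(4)] by (intro sum.mono_neutral_cong_right) auto
      moreover have "\<dots> = wd (x # w) + (\<Sum>k=2..?m. wd (Ghost \<alpha> k # Edge \<beta> k # w') :: _ \<Rightarrow>\<^sub>0 'r)"
        unfolding Ghost i w_eq by (subst sum.insert) auto
      ultimately show ?thesis
        unfolding act1 unfolding y w'_def[symmetric] Ghost reduct.simps
        by (simp add: cong_def algebra_simps)
    qed
  qed
qed

lemma cong_act:
  assumes "xs \<in> lists X" "n \<in> normal_span"
  shows "lin (\<lambda>w. wd (xs @ w)) n \<approx> act xs n"
  using assms(1)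
proof (induction xs)
  case (Cons x xs)
  then have x: "x \<in> X" and xs: "xs \<in> lists X" by auto
  have "lin (\<lambda>z. wd ([x] @ z @ [])) (lin (\<lambda>w. wd (xs @ w)) n) \<approx> lin (\<lambda>z. wd ([x] @ z @ [])) (act xs n)"
    using Cons xs x by (intro cong_context) auto
  also have "lin (\<lambda>z. wd ([x] @ z @ [])) (act xs n) \<approx> lin (act1 x) (act xs n)"
    using act_normal_span[OF assms(2) xs] x cong_act1 by (intro cong_lin) (auto simp: normal_span_def)
  finally show ?case by (simp add: lin_lin)
qed simp

text \<open>Normal words end in a vertex, so the normal form of \<open>f\<close> times
  \<open>v\<close> is found by letting \<open>f\<close> act on the normal word
  \<open>[Vertex v]\<close>.\<close>

lemma cong_normal_form:
  assumes "f \<in> words X" "v \<in> verts E"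
  shows "word_mult f (wd [Vertex v]) \<approx> f \<star> wd [Vertex v]"
  unfolding word_mult_single_right apply_poly_def
proof (rule cong_lin)
  fix xs
  assume "xs \<in> Poly_Mapping.keys f"
  then have "xs \<in> lists X" using assms by (auto simp: words_def)
  then show "wd (xs @ [Vertex v]) \<approx> act xs (wd [Vertex v])"
    using cong_act[OF _ normal_span_wd[OF normal_vertex[OF assms(2)]]] by simp
qed

end

text \<open>
  Compares the longest words on both sides: \<open>q\<close> contributes at least one letter to
  \<open>butlast p @ q\<close> beyond the length of \<open>p\<close>, and cancellation is impossible in a domain.
\<close>

lemma concat_equation_trivial:
  fixes B m :: "'a list \<Rightarrow>\<^sub>0 'r::ring_1_no_zero_divisors"
  assumes B: "\<And>p. p \<in> Poly_Mapping.keys B \<Longrightarrow> p \<noteq> [] \<and> last p = z"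
    and m: "\<And>q. q \<in> Poly_Mapping.keys m \<Longrightarrow> 2 \<le> length q"
    and eq: "B + m = lin (\<lambda>p. lin (\<lambda>q. wd (butlast p @ q)) m) B"
  shows "m = 0"
proof (rule ccontr)
  assume "m \<noteq> 0"
  then have "B \<noteq> 0" using eq by auto
  let ?kB = "Poly_Mapping.keys B" and ?km = "Poly_Mapping.keys m"
  have lookup_eq: "Poly_Mapping.lookup B W + Poly_Mapping.lookup m W =
      (\<Sum>p\<in>?kB. Poly_Mapping.lookup B p *
        (\<Sum>q\<in>?km. if butlast p @ q = W then Poly_Mapping.lookup m q else 0))" for W
    unfolding lookup_add[symmetric] eq lookup_lin
    by (intro sum.cong arg_cong2[where f = "(*)"] refl) (simp add: lookup_single when_def)
  have longest: "\<exists>w\<in>A. \<forall>w'\<in>A. length w' \<le> length w" if "finite A" "A \<noteq> {}" for A :: "'a list set"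
    using Max_in[of "length ` A"] Max_ge[of "length ` A"] that by fastforce
  obtain p0 where p0: "p0 \<in> ?kB" "\<And>p. p \<in> ?kB \<Longrightarrow> length p \<le> length p0"
    using longest[of ?kB] \<open>B \<noteq> 0\<close> by auto
  obtain q0 where q0: "q0 \<in> ?km" "\<And>q. q \<in> ?km \<Longrightarrow> length q \<le> length q0"
    using longest[of ?km] \<open>m \<noteq> 0\<close> by auto
  let ?W = "butlast p0 @ q0"
  \<comment> \<open>Both factors have maximal length in their supports, so \<open>?W\<close> arises
    from one pair only; \<open>p\<close> is recovered from \<open>butlast p\<close> because all
    words of \<open>B\<close> end in \<open>z\<close>.\<close>
  have W: "butlast p @ q = ?W \<longleftrightarrow> p = p0 \<and> q = q0" if "p \<in> ?kB" "q \<in> ?km" for p q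
  proof
    assume eq: "butlast p @ q = ?W"
    have "length (butlast p) \<le> length (butlast p0)" "length q \<le> length q0"
      using p0(2)[OF that(1)] q0(2)[OF that(2)] by auto
    moreover have "length (butlast p) + length q = length (butlast p0) + length q0"
      using arg_cong[OF eq, of length] by (simp only: length_append)
    ultimately have "length q = length q0" by linarith
    then have "butlast p = butlast p0 \<and> q = q0" using eq by simp
    then show "p = p0 \<and> q = q0"
      using B[OF that(1)] B[OF p0(1)] append_butlast_last_id by metis
  qed simp
  have "Poly_Mapping.lookup B ?W + Poly_Mapping.lookup m ?W =
      (\<Sum>p\<in>?kB. if p = p0 then Poly_Mapping.lookup B p *
        (\<Sum>q\<in>?km. if q = q0 then Poly_Mapping.lookup m q else 0) else 0)"
    unfolding lookup_eq
  proof (intro sum.cong refl)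
    fix p
    assume p: "p \<in> ?kB"
    have "(\<Sum>q\<in>?km. if butlast p @ q = ?W then Poly_Mapping.lookup m q else 0) =
        (\<Sum>q\<in>?km. if p = p0 \<and> q = q0 then Poly_Mapping.lookup m q else 0)"
      using W[OF p] by (intro sum.cong) auto
    then show "Poly_Mapping.lookup B p *
        (\<Sum>q\<in>?km. if butlast p @ q = ?W then Poly_Mapping.lookup m q else 0) =
      (if p = p0 then Poly_Mapping.lookup B p *
        (\<Sum>q\<in>?km. if q = q0 then Poly_Mapping.lookup m q else 0) else 0)"
      by simp
  qed
  also have "\<dots> = Poly_Mapping.lookup B p0 * Poly_Mapping.lookup m q0"
    using p0(1) q0(1) by simp
  also have "\<dots> \<noteq> 0" using p0(1) q0(1) by (simp add: in_keys_iff)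
  finally have "?W \<in> ?kB \<or> ?W \<in> ?km" by (auto simp: in_keys_iff)
  \<comment> \<open>In \<open>B\<close>, the word \<open>?W\<close> would be longer than
    \<open>p0\<close>, as \<open>q0\<close> has at least two letters. So it occurs in
    \<open>m\<close>, where it cannot be longer than \<open>q0\<close>; hence
    \<open>butlast p0\<close> is empty.\<close>
  then have "length p0 \<le> 1"
    using p0(2)[of ?W] q0(2)[of ?W] m[OF q0(1)] by auto
  then have len: "length p \<le> 1" if "p \<in> ?kB" for p
    using p0(2)[OF that] by simp
  \<comment> \<open>Now \<open>[z]\<close> is the only word of \<open>B\<close>. All concatenations
    have at least two letters and \<open>m\<close> does not contain \<open>[z]\<close>, so its
    coefficient in \<open>B\<close> vanishes, against the choice of \<open>p0\<close>.\<close>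
  have "p0 = [z]" using len[OF p0(1)] B[OF p0(1)] by (cases p0) auto
  moreover have "[z] \<notin> ?km" using m[of "[z]"] by auto
  moreover have "butlast p @ q \<noteq> [z]" if "q \<in> ?km" for p q
    using m[OF that] by (auto dest: arg_cong[of _ _ length])
  then have "Poly_Mapping.lookup B [z] + Poly_Mapping.lookup m [z] = 0"
    unfolding lookup_eq by (intro sum.neutral ballI) (simp add: sum.neutral)
  ultimately show False using p0(1) by (simp add: in_keys_iff)
qed

context special_arcs
begin

lemma last_keys_act:
  fixes n :: "_ \<Rightarrow>\<^sub>0 'r::ring_1"
  assumes "n \<in> normal_span" "xs \<in> lists X" "\<And>w. w \<in> Poly_Mapping.keys n \<Longrightarrow> last w = z"
    and "w' \<in> Poly_Mapping.keys (act xs n)"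
  shows "last w' = z"
  using assms(2,4)
proof (induction xs arbitrary: w')
  case Nil
  then show ?case using assms(3) by simp
next
  case (Cons x xs)
  then obtain w where w: "w \<in> Poly_Mapping.keys (act xs n)"
      "w' \<in> Poly_Mapping.keys (act1 x w :: _ \<Rightarrow>\<^sub>0 'r)"
    using keys_lin[of "act1 x" "act xs n"] by auto
  have "normal w" using act_normal_span[OF assms(1), of xs] w Cons by (auto simp: normal_span_def)
  then show ?case using keys_act1[OF _ _ w(2)] Cons w by auto
qed

lemma last_keys_apply:
  fixes n :: "_ \<Rightarrow>\<^sub>0 'r::ring_1"
  assumes "n \<in> normal_span" "f \<in> words X" "\<And>w. w \<in> Poly_Mapping.keys n \<Longrightarrow> last w = z"
    and "w' \<in> Poly_Mapping.keys (f \<star> n)"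
  shows "last w' = z"
proof -
  obtain xs where "xs \<in> Poly_Mapping.keys f" "w' \<in> Poly_Mapping.keys (act xs n)"
    using assms(4) keys_lin[of "\<lambda>xs. act xs n" f] unfolding apply_poly_def by blast
  moreover have "xs \<in> lists X" using calculation assms(2) by (auto simp: words_def)
  ultimately show ?thesis using last_keys_act assms by blast
qed

end

section \<open>Local units, and moving the ends of an element to non-sinks\<close>

context wlpa
begin

text \<open>The finite sum of the vertices where words of \<open>f\<close> end is a right local
  unit: each word is fixed by its own range and killed by the other vertices.\<close>

lemma cong_mult_vertex_right:
  assumes "f \<in> words X"
  shows "f \<approx> (\<Sum>v\<in>rng ` last ` Poly_Mapping.keys f. word_mult f (wd [Vertex v]))"
proof -
  let ?S = "rng ` last ` Poly_Mapping.keys f"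
  have "(\<Sum>v\<in>?S. word_mult f (wd [Vertex v])) = lin (\<lambda>xs. \<Sum>v\<in>?S. wd (xs @ [Vertex v])) f"
    by (simp add: word_mult_single_right lin_sum_fun)
  also have "\<dots> \<approx> lin (\<lambda>xs. wd xs) f"
  proof (rule cong_lin)
    fix xs
    assume xs: "xs \<in> Poly_Mapping.keys f"
    have xsX: "ys \<in> lists X \<and> ys \<noteq> []" if "ys \<in> Poly_Mapping.keys f" for ys
      using that assms by (auto simp: words_def)
    have last: "last ys \<in> X" if "ys \<in> Poly_Mapping.keys f" for ys
      using xsX[OF that] by auto
    have split: "xs = butlast xs @ [last xs]" using xsX[OF xs] by simp
    have "wd (xs @ [Vertex v]) \<approx> (if v = rng (last xs) then wd xs else 0)" if "v \<in> ?S" for v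
    proof -
      have v: "v \<in> verts E" using that last rng_in_verts by auto
      have b: "butlast xs \<in> lists X" using xsX[OF xs] by (auto dest: in_set_butlastD)
      have "wd [last xs, Vertex v] \<approx> (if v = rng (last xs) then wd [last xs] else 0)"
        using cong_range_letter[OF last[OF xs]] cong_mismatch[OF last[OF xs], of "[Vertex v]"] v
        by (auto simp: Vertex_in_X)
      from cong_context[OF this b, of "[]"]
      have "wd (butlast xs @ [last xs] @ [Vertex v]) \<approx>
          (if v = rng (last xs) then wd (butlast xs @ [last xs]) else 0)"
        by (simp add: lin_if cong: if_cong split: if_splits)
      then show ?thesis unfolding append_assoc[symmetric] split[symmetric] .
    qed
    then have "(\<Sum>v\<in>?S. wd (xs @ [Vertex v])) \<approx> (\<Sum>v\<in>?S. if v = rng (last xs) then wd xs else 0)"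
      by (rule cong_sum)
    then show "(\<Sum>v\<in>?S. wd (xs @ [Vertex v])) \<approx> wd xs"
      using xs by simp
  qed
  finally show ?thesis by (simp add: cong_sym)
qed

lemma cong_mult_vertex_left:
  assumes "f \<in> words X"
  shows "f \<approx> (\<Sum>v\<in>src ` hd ` Poly_Mapping.keys f. word_mult (wd [Vertex v]) f)"
proof -
  let ?S = "src ` hd ` Poly_Mapping.keys f"
  have "(\<Sum>v\<in>?S. word_mult (wd [Vertex v]) f) = lin (\<lambda>xs. \<Sum>v\<in>?S. wd ([Vertex v] @ xs)) f"
    by (simp only: word_mult_single_left lin_sum_fun)
  also have "\<dots> \<approx> lin (\<lambda>xs. wd xs) f"
  proof (rule cong_lin)
    fix xs
    assume xs: "xs \<in> Poly_Mapping.keys f"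
    have xsX: "ys \<in> lists X \<and> ys \<noteq> []" if "ys \<in> Poly_Mapping.keys f" for ys
      using that assms by (auto simp: words_def)
    have hd: "hd ys \<in> X" if "ys \<in> Poly_Mapping.keys f" for ys
      using xsX[OF that] by (cases ys) auto
    have "wd ([Vertex v] @ xs) \<approx> (if v = src (hd xs) then wd xs else 0)" if "v \<in> ?S" for v
    proof -
      have "v \<in> verts E" using that hd src_in_verts by auto
      then show ?thesis
        using cong_source[of xs] cong_mismatch[of "Vertex v" xs] xsX[OF xs]
        by (auto simp: Vertex_in_X)
    qed
    then have "(\<Sum>v\<in>?S. wd ([Vertex v] @ xs)) \<approx> (\<Sum>v\<in>?S. if v = src (hd xs) then wd xs else 0)"
      by (rule cong_sum)
    then show "(\<Sum>v\<in>?S. wd ([Vertex v] @ xs)) \<approx> wd xs"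
      using xs by simp
  qed
  finally show ?thesis by (simp add: cong_sym)
qed

text \<open>Relation (4) for a single arc. It factors a sink through the tail of an incoming arc,
  which is never a sink.\<close>

lemma cong_vertex_ghost_edge:
  assumes "\<delta> \<in> arcs E"
  shows "wd [Vertex (head E \<delta>)] \<approx> (\<Sum>i=1..\<omega> \<delta>. word_mult (wd [Ghost \<delta> i]) (wd [Edge \<delta> i]))"
proof -
  have "(\<Sum>i=1..\<omega> \<delta>. if i \<le> \<omega> \<delta> then wd [Ghost \<delta> i, Edge \<delta> i] else 0) =
      (\<Sum>i=1..\<omega> \<delta>. wd [Ghost \<delta> i, Edge \<delta> i] :: _ \<Rightarrow>\<^sub>0 'r)"
    by (intro sum.cong) auto
  then show ?thesis using cong_sym[OF cong_ghost_edge[OF assms assms]] by simp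
qed

text \<open>By the local unit, some \<open>f v\<close> is nonzero in the algebra. If
  \<open>v\<close> is a sink, it is split along an incoming arc \<open>\<delta>\<close>: some
  \<open>f \<delta>\<^sub>i\<^sup>* \<delta>\<^sub>i\<close> is nonzero, hence so is
  \<open>f \<delta>\<^sub>i\<^sup>*\<close>, which ends at the tail of
  \<open>\<delta>\<close>.\<close>

lemma not_ideal_right_letter:
  assumes "f \<in> words X" "f \<notin> I" and sinks: "\<And>v. v \<in> verts E \<Longrightarrow> sink E v \<Longrightarrow> \<exists>\<delta>\<in>arcs E. head E \<delta> = v"
  shows "\<exists>x\<in>X. \<not> sink E (rng x) \<and> word_mult f (wd [x]) \<notin> I"
proof -
  let ?S = "rng ` last ` Poly_Mapping.keys f"
  have "(\<Sum>v\<in>?S. word_mult f (wd [Vertex v])) \<notin> I"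
    using cong_ideal[OF cong_mult_vertex_right[OF assms(1)]] assms(2) by simp
  then obtain v where v: "v \<in> ?S" "word_mult f (wd [Vertex v]) \<notin> I"
    using ideal_sum[of ?S "\<lambda>v. word_mult f (wd [Vertex v])"] by auto
  have "last ys \<in> X" if "ys \<in> Poly_Mapping.keys f" for ys
    using that assms by (cases ys rule: rev_cases) (auto simp: words_def)
  then have vE: "v \<in> verts E" using v(1) rng_in_verts by auto
  show ?thesis
  proof (cases "sink E v")
    case False
    then show ?thesis using v vE by (intro bexI[of _ "Vertex v"]) (auto simp: Vertex_in_X)
  next
    case True
    then obtain \<delta> where \<delta>: "\<delta> \<in> arcs E" "head E \<delta> = v" using sinks vE by blast
    have "word_mult f (wd [Vertex v]) \<approx>
        word_mult f (\<Sum>i=1..\<omega> \<delta>. word_mult (wd [Ghost \<delta> i]) (wd [Edge \<delta> i]))"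
      using cong_vertex_ghost_edge[OF \<delta>(1)] \<delta>(2) assms(1) by (intro cong_mult_left) simp_all
    also have "word_mult f (\<Sum>i=1..\<omega> \<delta>. word_mult (wd [Ghost \<delta> i]) (wd [Edge \<delta> i])) =
        (\<Sum>i=1..\<omega> \<delta>. word_mult (word_mult f (wd [Ghost \<delta> i])) (wd [Edge \<delta> i]))"
      by (simp only: word_mult_sum_right word_mult_assoc)
    finally have "(\<Sum>i=1..\<omega> \<delta>. word_mult (word_mult f (wd [Ghost \<delta> i])) (wd [Edge \<delta> i])) \<notin> I"
      using v(2) cong_ideal by blast
    then obtain i where i: "i \<in> {1..\<omega> \<delta>}"
        "word_mult (word_mult f (wd [Ghost \<delta> i])) (wd [Edge \<delta> i]) \<notin> I"
      using ideal_sum[of "{1..\<omega> \<delta>}" "\<lambda>i. word_mult (word_mult f (wd [Ghost \<delta> i])) (wd [Edge \<delta> i])"] by auto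
    then have "word_mult f (wd [Ghost \<delta> i]) \<notin> I"
      using ideal_mult_right[of "word_mult f (wd [Ghost \<delta> i])" "wd [Edge \<delta> i]"] \<delta>(1)
      by (auto simp: Edge_in_X words_single)
    then show ?thesis
      using i \<delta> not_sink_tail by (intro bexI[of _ "Ghost \<delta> i"]) (auto simp: Ghost_in_X)
  qed
qed

text \<open>Mirror image: here the factor \<open>\<delta>\<^sub>i\<close> is kept, which starts at
  the tail of \<open>\<delta>\<close>.\<close>

lemma not_ideal_left_letter:
  assumes "f \<in> words X" "f \<notin> I" and sinks: "\<And>v. v \<in> verts E \<Longrightarrow> sink E v \<Longrightarrow> \<exists>\<delta>\<in>arcs E. head E \<delta> = v"
  shows "\<exists>x\<in>X. \<not> sink E (src x) \<and> word_mult (wd [x]) f \<notin> I"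
proof -
  let ?S = "src ` hd ` Poly_Mapping.keys f"
  have "(\<Sum>v\<in>?S. word_mult (wd [Vertex v]) f) \<notin> I"
    using cong_ideal[OF cong_mult_vertex_left[OF assms(1)]] assms(2) by simp
  then obtain v where v: "v \<in> ?S" "word_mult (wd [Vertex v]) f \<notin> I"
    using ideal_sum[of ?S "\<lambda>v. word_mult (wd [Vertex v]) f"] by auto
  have "hd ys \<in> X" if "ys \<in> Poly_Mapping.keys f" for ys
    using that assms by (cases ys) (auto simp: words_def)
  then have vE: "v \<in> verts E" using v(1) src_in_verts by auto
  show ?thesis
  proof (cases "sink E v")
    case False
    then show ?thesis using v vE by (intro bexI[of _ "Vertex v"]) (auto simp: Vertex_in_X)
  next
    case True
    then obtain \<delta> where \<delta>: "\<delta> \<in> arcs E" "head E \<delta> = v" using sinks vE by blast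
    have "word_mult (wd [Vertex v]) f \<approx>
        word_mult (\<Sum>i=1..\<omega> \<delta>. word_mult (wd [Ghost \<delta> i]) (wd [Edge \<delta> i])) f"
      using cong_vertex_ghost_edge[OF \<delta>(1)] \<delta>(2) assms(1) by (intro cong_mult_right) simp_all
    also have "word_mult (\<Sum>i=1..\<omega> \<delta>. word_mult (wd [Ghost \<delta> i]) (wd [Edge \<delta> i])) f =
        (\<Sum>i=1..\<omega> \<delta>. word_mult (wd [Ghost \<delta> i]) (word_mult (wd [Edge \<delta> i]) f))"
      by (simp only: word_mult_sum_left word_mult_assoc)
    finally have "(\<Sum>i=1..\<omega> \<delta>. word_mult (wd [Ghost \<delta> i]) (word_mult (wd [Edge \<delta> i]) f)) \<notin> I"
      using v(2) cong_ideal by blast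
    then obtain i where i: "i \<in> {1..\<omega> \<delta>}"
        "word_mult (wd [Ghost \<delta> i]) (word_mult (wd [Edge \<delta> i]) f) \<notin> I"
      using ideal_sum[of "{1..\<omega> \<delta>}" "\<lambda>i. word_mult (wd [Ghost \<delta> i]) (word_mult (wd [Edge \<delta> i]) f)"] by auto
    then have "word_mult (wd [Edge \<delta> i]) f \<notin> I"
      using ideal_mult_left[of "word_mult (wd [Edge \<delta> i]) f" "wd [Ghost \<delta> i]"] \<delta>(1)
      by (auto simp: Ghost_in_X words_single)
    then show ?thesis
      using i \<delta> not_sink_tail by (intro bexI[of _ "Edge \<delta> i"]) (auto simp: Edge_in_X)
  qed
qed

end


section \<open>Semiprimitivity for LV-graphs\<close>

context lv_graph
begin

text \<open>A generalised path from \<open>v\<close> to the tail of some arc is not a single vertex,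
  since that tail is not a sink. Its first letter starts at \<open>v\<close>, so it cannot be an
  edge and is the ghost of an arc ending at \<open>v\<close>.\<close>

lemma sink_in_arc:
  assumes "v \<in> verts E" "sink E v"
  shows "\<exists>\<delta>\<in>arcs E. head E \<delta> = v"
proof -
  obtain e where e: "e \<in> arcs E" using arcs_nonempty by blast
  have ne: "v \<noteq> tail E \<alpha>" if "\<alpha> \<in> arcs E" for \<alpha>
    using assms(2) that by (auto simp: sink_def)
  obtain p where p: "generalised_path E \<omega> p" "letter_source E (hd p) = v"
      "letter_range E (last p) = tail E e"
    using connected[OF assms(1) tail_in_verts[OF e]] by blast
  have "p \<noteq> [Vertex u]" for u using p ne[OF e] by auto
  then have "p \<noteq> []" "set p \<subseteq> edges E \<omega> \<union> ghost_edges E \<omega>"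
    using p(1) by (auto simp: generalised_path_def)
  then have "hd p \<in> edges E \<omega> \<union> ghost_edges E \<omega>" by (cases p) auto
  then show ?thesis using p(2) ne by (fastforce simp: edges_def ghost_edges_def)
qed

lemma special_arcs_exist: "\<exists>sp. special_arcs E \<omega> sp"
proof -
  have "\<exists>\<alpha>. \<alpha> \<in> out_arcs E v \<and> \<omega> \<alpha> = vertex_weight E \<omega> v" if "v \<in> verts E" "\<not> sink E v" for v
  proof -
    have "{\<alpha> \<in> out_arcs E v. \<omega> \<alpha> = vertex_weight E \<omega> v} \<noteq> {}"
      using two_max_weight[OF that] by (metis card.empty not_numeral_le_zero)
    then show ?thesis by blast
  qed
  then obtain sp where "\<And>v. v \<in> verts E \<Longrightarrow> \<not> sink E v \<Longrightarrow>
      sp v \<in> out_arcs E v \<and> \<omega> (sp v) = vertex_weight E \<omega> v"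
    by metis
  then show ?thesis by (intro exI[of _ sp]) unfold_locales
qed

end

locale lv_wlpa = lv_graph E \<omega> + wlpa E \<omega> sp I
  for E :: "('v, 'e) pre_digraph" and \<omega> sp
    and I :: "(('v, 'e) letter list \<Rightarrow>\<^sub>0 'r::ring_1_no_zero_divisors) set"
begin

text \<open>At least two arcs of maximal weight leave \<open>v\<close>, and at most one of them is
  \<open>sp v\<close>.\<close>

lemma nonspecial_arc:
  assumes "v \<in> verts E" "\<not> sink E v"
  shows "\<exists>\<gamma>\<in>out_arcs E v. \<gamma> \<noteq> sp v"
proof (rule ccontr)
  assume "\<not> ?thesis"
  then have "{\<alpha> \<in> out_arcs E v. \<omega> \<alpha> = vertex_weight E \<omega> v} \<subseteq> {sp v}" by blast
  then have "card {\<alpha> \<in> out_arcs E v. \<omega> \<alpha> = vertex_weight E \<omega> v} \<le> 1"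
    using card_mono[of "{sp v}"] by fastforce
  then show False using two_max_weight[OF assms] by simp
qed

text \<open>
  With all indices equal to 2, the only forbidden pairs are \<open>\<alpha>\<^sub>2 \<alpha>\<^sub>2\<^sup>*\<close>; these are closed paths and
  can be deleted.
\<close>

lemma normal_path_of_path:
  assumes "p \<noteq> []" "set p \<subseteq> edges E \<omega> \<union> ghost_edges E \<omega>"
    and "\<And>i. Suc i < length p \<Longrightarrow> rng (p ! i) = src (p ! Suc i)"
  shows "\<exists>c. normal c \<and> src (hd c) = src (hd p) \<and> last c = Vertex (rng (last p))"
proof -
  have "\<exists>c. normal c \<and> src (hd c) = src (hd p) \<and> last c = Vertex (rng (last p)) \<and>
      (\<forall>\<alpha> i. Edge \<alpha> i \<in> set c \<or> Ghost \<alpha> i \<in> set c \<longrightarrow> i = 2)"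
    using assms
  proof (induction p)
    case (Cons x p)
    have x: "x \<in> edges E \<omega> \<union> ghost_edges E \<omega>" using Cons by simp
    then have xX: "x \<in> X" by (auto simp: generators_def)
    have "\<exists>c. normal c \<and> src (hd c) = rng x \<and> last c = Vertex (rng (last (x # p))) \<and>
        (\<forall>\<alpha> i. Edge \<alpha> i \<in> set c \<or> Ghost \<alpha> i \<in> set c \<longrightarrow> i = 2)"
    proof (cases "p = []")
      case True
      then show ?thesis
        using rng_in_verts[OF xX] by (intro exI[of _ "[Vertex (rng x)]"]) (auto intro: normal_vertex)
    next
      case False
      have "rng (p ! i) = src (p ! Suc i)" if "Suc i < length p" for i
        using Cons.prems(3)[of "Suc i"] that by simp
      moreover have "rng x = src (hd p)"
        using Cons.prems(3)[of 0] False by (simp add: hd_conv_nth)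
      ultimately show ?thesis using Cons False by auto
    qed
    then obtain c where c: "normal c" "src (hd c) = rng x" "last c = Vertex (rng (last (x # p)))"
      "\<And>\<alpha> i. Edge \<alpha> i \<in> set c \<or> Ghost \<alpha> i \<in> set c \<Longrightarrow> i = 2" by blast
    have ne: "c \<noteq> []" using normal_not_Nil c by blast
    show ?case
    proof (cases x)
      case (Vertex v)
      then show ?thesis using x by (auto simp: edges_def ghost_edges_def)
    next
      case (Ghost \<alpha> i)
      then have \<alpha>: "\<alpha> \<in> arcs E" using xX by (simp add: Ghost_in_X)
      have "\<not> forbidden (Ghost \<alpha> 2) (hd c)" by (cases "hd c") auto
      then have "normal (Ghost \<alpha> 2 # c)"
        using c \<alpha> weight_ge_2[OF \<alpha>] Ghost by (simp add: normal_Ghost_iff)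
      then show ?thesis using c ne Ghost by (intro exI[of _ "Ghost \<alpha> 2 # c"]) auto
    next
      case (Edge \<alpha> i)
      then have \<alpha>: "\<alpha> \<in> arcs E" using xX by (simp add: Edge_in_X)
      show ?thesis
      proof (cases "forbidden (Edge \<alpha> 2) (hd c)")
        case False
        then have "normal (Edge \<alpha> 2 # c)"
          using c \<alpha> weight_ge_2[OF \<alpha>] Edge by (simp add: normal_Edge_iff)
        then show ?thesis using c ne Edge by (intro exI[of _ "Edge \<alpha> 2 # c"]) auto
      next
        case True
        then obtain j c' where c': "c = Ghost \<alpha> j # c'" using ne by (cases c; cases "hd c") auto
        then have n: "normal c'" "tail E \<alpha> = src (hd c')" using c(1) by (auto simp: normal_Ghost_iff)
        then have "c' \<noteq> []" using normal_not_Nil by blast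
        then show ?thesis using c c' n Edge by (intro exI[of _ c']) auto
      qed
    qed
  qed simp
  then show ?thesis by blast
qed

lemma normal_path_between:
  assumes "u \<in> verts E" "v \<in> verts E"
  shows "\<exists>c. normal c \<and> src (hd c) = u \<and> last c = Vertex v"
proof -
  obtain p where p: "generalised_path E \<omega> p" "src (hd p) = u" "rng (last p) = v"
    using connected[OF assms] by blast
  show ?thesis
  proof (cases "\<exists>w\<in>verts E. p = [Vertex w]")
    case True
    then show ?thesis using p by (intro exI[of _ p]) (auto intro: normal_vertex)
  next
    case False
    then show ?thesis using p normal_path_of_path[of p] by (auto simp: generalised_path_def)
  qed
qed

lemma quasi_regular_ideal_trivial:
  assumes J: "rng_ideal J (free_rng X Quot I)"
    and qr: "\<And>a. a \<in> J \<Longrightarrow> left_quasi_regular (free_rng X Quot I) a"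
    and f: "f \<in> words X" "coset f \<in> J"
  shows "f \<in> I"
proof (rule ccontr)
  assume "f \<notin> I"
  have J_left: "coset (word_mult h g) \<in> J" and J_right: "coset (word_mult g h) \<in> J"
    if "coset g \<in> J" "g \<in> words X" "h \<in> words X" for g h
  proof -
    have "coset h \<in> carrier (free_rng X Quot I)" using that by (auto simp: carrier_quot)
    then show "coset (word_mult h g) \<in> J" "coset (word_mult g h) \<in> J"
      using J that unfolding rng_ideal_def by (metis mult_quot)+
  qed
  \<comment> \<open>\<open>f\<close> is going to be replaced by \<open>f2\<close>, the product of
    \<open>x\<close>, \<open>f\<close> and \<open>y\<close>: a nonzero element of \<open>J\<close>
    that starts and ends at non-sinks.\<close>
  obtain y where y: "y \<in> X" "\<not> sink E (rng y)" "word_mult f (wd [y]) \<notin> I"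
    using not_ideal_right_letter[OF f(1) \<open>f \<notin> I\<close> sink_in_arc] by blast
  have yw: "(wd [y] :: _ \<Rightarrow>\<^sub>0 'r) \<in> words X" using y by (simp add: words_single)
  define f1 where "f1 = word_mult f (wd [y])"
  have f1: "f1 \<in> words X" "coset f1 \<in> J" "f1 \<notin> I"
    using y f yw J_right by (auto simp: f1_def words_mult)
  obtain x where x: "x \<in> X" "\<not> sink E (src x)" "word_mult (wd [x]) f1 \<notin> I"
    using not_ideal_left_letter[OF f1(1,3) sink_in_arc] by blast
  have xw: "(wd [x] :: _ \<Rightarrow>\<^sub>0 'r) \<in> words X" using x by (simp add: words_single)
  define f2 where "f2 = word_mult (wd [x]) f1"
  have f2: "f2 \<in> words X" "coset f2 \<in> J" "f2 \<notin> I"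
    using x f1 xw J_left by (auto simp: f2_def words_mult)
  define u v where "u = src x" and "v = rng y"
  have uv: "u \<in> verts E" "v \<in> verts E" "\<not> sink E u" "\<not> sink E v"
    using x y src_in_verts rng_in_verts by (auto simp: u_def v_def)

  \<comment> \<open>The normal form of \<open>f2\<close>, with all words running from
    \<open>u\<close> to \<open>v\<close>. It represents \<open>f2\<close> itself because
    \<open>y\<close> ends at \<open>v\<close>.\<close>
  define n where "n = f2 \<star> wd [Vertex v]"
  have v_span: "(wd [Vertex v] :: _ \<Rightarrow>\<^sub>0 'r) \<in> normal_span"
    using uv by (intro normal_span_wd normal_vertex)
  have n_span: "n \<in> normal_span"
    unfolding n_def by (rule apply_normal_span[OF v_span f2(1)])
  have n_last: "last w = Vertex v" if "w \<in> Poly_Mapping.keys n" for w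
    using last_keys_apply[OF v_span f2(1) _ that[unfolded n_def]] by simp
  have n_src: "src (hd w) = u" if w: "w \<in> Poly_Mapping.keys n" for w
  proof -
    let ?k = "f1 \<star> wd [Vertex v]"
    have "n = lin (act1 x) ?k" by (simp add: n_def f2_def apply_mult apply_wd)
    then obtain w' where w': "w' \<in> Poly_Mapping.keys ?k" "w \<in> Poly_Mapping.keys (act1 x w' :: _ \<Rightarrow>\<^sub>0 'r)"
      using w keys_lin[of "act1 x" ?k] by auto
    have "normal w'" using w'(1) apply_normal_span[OF v_span f1(1)] by (auto simp: normal_span_def)
    then show ?thesis using keys_act1[OF _ x(1) w'(2)] by (simp add: u_def)
  qed
  have "word_mult f2 (wd [Vertex v]) \<approx> f2"
  proof -
    have "word_mult (word_mult (wd [x]) f) (wd [y, Vertex v]) \<approx> word_mult (word_mult (wd [x]) f) (wd [y])"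
      using cong_range_letter[OF y(1)] xw f(1) by (intro cong_mult_left words_mult) (simp_all add: v_def)
    then show ?thesis
      by (simp add: f2_def f1_def word_mult_assoc)
  qed
  then have f2_n: "f2 \<approx> n"
    using cong_normal_form[OF f2(1) uv(2)] cong_sym cong_trans unfolding n_def by blast
  then have "n \<noteq> 0" using f2(3) cong_ideal ideal_zero by blast
  have n_words: "n \<in> words X"
    using n_span normal_lists normal_not_Nil by (auto simp: normal_span_def words_def)
  have n_J: "coset n \<in> J" using f2(2) f2_n coset_eq_iff by metis

  obtain \<gamma> where \<gamma>: "\<gamma> \<in> arcs E" "tail E \<gamma> = u" "\<gamma> \<noteq> sp u" using nonspecial_arc[OF uv(1,3)] by auto
  obtain \<epsilon> where \<epsilon>: "\<epsilon> \<in> arcs E" "tail E \<epsilon> = v" "\<epsilon> \<noteq> sp v" using nonspecial_arc[OF uv(2,4)] by auto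
  define t where "t = head E \<gamma>"
  have t: "t \<in> verts E" using \<gamma> by (simp add: t_def)
  obtain c0 where c0: "normal c0" "src (hd c0) = v" "last c0 = Vertex t"
    using normal_path_between[OF uv(2) t] by blast
  \<comment> \<open>The index \<open>2\<close> of its first letter lets \<open>c\<close> follow any
    normal word ending at \<open>v\<close>. The choice of \<open>\<epsilon>\<close> keeps
    \<open>\<epsilon>\<^sub>2 \<epsilon>\<^sub>2\<^sup>*\<close> from being forbidden, and a ghost
    of index \<open>2\<close> may precede whatever \<open>c0\<close> starts with.\<close>
  define c where "c = Edge \<epsilon> 2 # Ghost \<epsilon> 2 # c0"
  have "\<not> forbidden (Ghost \<epsilon> 2) (hd c0)" by (cases "hd c0") auto
  then have c: "normal c" "src (hd c) = v" "last c = Vertex t" "\<And>z. \<not> forbidden z (hd c)"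
    using c0 \<epsilon> weight_ge_2[OF \<epsilon>(1)] normal_not_Nil[OF c0(1)]
    by (auto simp: c_def normal_Edge_iff normal_Ghost_iff elim: forbidden.elims)
  have cw: "(wd c :: _ \<Rightarrow>\<^sub>0 'r) \<in> words X" using normal_lists[OF c(1)] normal_not_Nil[OF c(1)] by (simp add: words_single)
  have ghost: "Ghost \<gamma> 2 \<in> X" using \<gamma> weight_ge_2 by (simp add: Ghost_in_X)
  have ghostw: "(wd [Ghost \<gamma> 2] :: _ \<Rightarrow>\<^sub>0 'r) \<in> words X" using ghost by (simp add: words_single)

  \<comment> \<open>Both ends of \<open>g\<close> are at \<open>t\<close>: the ghost starts at the
    head of \<open>\<gamma>\<close>, and \<open>c\<close> ends there.\<close>
  define g where "g = word_mult (wd [Ghost \<gamma> 2]) (word_mult n (wd c))"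
  have g: "g \<in> words X" "coset g \<in> J"
    unfolding g_def by (intro words_mult J_left J_right n_words n_J cw ghostw)+
  \<comment> \<open>The word of \<open>g\<close> coming from the word \<open>w\<close> of
    \<open>n\<close>; \<open>butlast\<close> drops the final vertex of \<open>w\<close>, as
    \<open>c\<close> supplies the only vertex of the result.\<close>
  define \<phi> where "\<phi> w = Ghost \<gamma> 2 # butlast w @ c" for w
  have t_span: "(wd [Vertex t] :: _ \<Rightarrow>\<^sub>0 'r) \<in> normal_span" using t by (intro normal_span_wd normal_vertex)
  have c_eq: "c = butlast c @ [Vertex t]"
    using append_butlast_last_id[OF normal_not_Nil[OF c(1)]] c(3) by simp
  have nf: "\<not> forbidden z (hd [Vertex t])" for z by (cases z) simp_all
  \<comment> \<open>A normal word applied to its own final vertex reproduces itself.\<close>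
  have act_c: "act c (wd [Vertex t]) = (wd c :: _ \<Rightarrow>\<^sub>0 'r)"
    by (subst (2) c_eq, rule conjunct1[OF act_concat[OF c(1,3) normal_vertex[OF t] _ nf]]) simp
  have \<phi>: "lin (act1 (Ghost \<gamma> 2)) (act w (wd c)) = (wd (\<phi> w) :: _ \<Rightarrow>\<^sub>0 'r) \<and> normal (\<phi> w)"
    if w: "w \<in> Poly_Mapping.keys n" for w
  proof -
    have nw: "normal w" using w n_span by (auto simp: normal_span_def)
    have a: "act w (wd c) = (wd (butlast w @ c) :: _ \<Rightarrow>\<^sub>0 'r)" "normal (butlast w @ c)"
      using act_concat[OF nw n_last[OF w] c(1,2)] c(4) by auto
    have "src (hd (butlast w @ c)) = u"
    proof (cases "butlast w")
      case Nil
      then have "w = [Vertex v]"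
        using n_last[OF w] append_butlast_last_id[OF normal_not_Nil[OF nw]] by simp
      then show ?thesis using n_src[OF w] c(2) by simp
    next
      case (Cons z zs)
      then have "hd (butlast w @ c) = hd w"
        using append_butlast_last_id[OF normal_not_Nil[OF nw]] by (metis append_Cons list.sel(1))
      then show ?thesis using n_src[OF w] by simp
    qed
    moreover have "\<not> forbidden (Ghost \<gamma> 2) (hd (butlast w @ c))"
      by (cases "hd (butlast w @ c)") auto
    ultimately show ?thesis
      using a \<gamma> weight_ge_2[OF \<gamma>(1)] by (simp add: \<phi>_def normal_Ghost_iff act1_def)
  qed
  \<comment> \<open>The normal form of \<open>g\<close>. No reduction happens on the way, so it is
    \<open>n\<close> with its words relabelled by \<open>\<phi>\<close>.\<close>
  define m where "m = g \<star> wd [Vertex t]"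
  have "m = lin (act1 (Ghost \<gamma> 2)) (n \<star> wd c)"
    by (simp add: m_def g_def apply_mult apply_wd act_c)
  also have "\<dots> = lin (\<lambda>w. lin (act1 (Ghost \<gamma> 2)) (act w (wd c))) n"
    by (simp add: apply_poly_def lin_lin)
  also have "\<dots> = lin (\<lambda>w. wd (\<phi> w)) n"
    using \<phi> by (intro lin_cong) blast
  finally have m_eq: "m = lin (\<lambda>w. wd (\<phi> w)) n" .
  have m_keys: "\<exists>w\<in>Poly_Mapping.keys n. q = \<phi> w" if "q \<in> Poly_Mapping.keys m" for q
    using that keys_lin[of "\<lambda>w. wd (\<phi> w)" n] unfolding m_eq by fastforce
  have m_nf: "normal q \<and> hd q = Ghost \<gamma> 2 \<and> 2 \<le> length q" if "q \<in> Poly_Mapping.keys m" for q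
    using m_keys[OF that] \<phi> by (auto simp: \<phi>_def c_def)
  have m_span: "m \<in> normal_span" using m_nf by (auto simp: normal_span_def)
  have "m \<noteq> 0"
  proof -
    \<comment> \<open>All words of \<open>n\<close> end in the same vertex, so
      \<open>butlast\<close> loses no information.\<close>
    have "inj_on \<phi> (Poly_Mapping.keys n)"
    proof (rule inj_onI)
      fix w w'
      assume w: "w \<in> Poly_Mapping.keys n" "w' \<in> Poly_Mapping.keys n" "\<phi> w = \<phi> w'"
      have "w \<noteq> []" "w' \<noteq> []" using w n_span normal_not_Nil by (auto simp: normal_span_def)
      then show "w = w'"
        using n_last w append_butlast_last_id by (metis \<phi>_def append_same_eq list.inject)
    qed
    moreover obtain w where "w \<in> Poly_Mapping.keys n" using \<open>n \<noteq> 0\<close> by (metis equals0I keys_eq_empty)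
    ultimately show ?thesis
      using lookup_lin_wd_inj[of \<phi> n w] unfolding m_eq by (auto simp: in_keys_iff)
  qed

  obtain b where b: "b \<in> words X"
      "coset b \<oplus>\<^bsub>free_rng X Quot I\<^esub> coset g = coset b \<otimes>\<^bsub>free_rng X Quot I\<^esub> coset g"
    using qr[OF g(2)] by (auto simp: left_quasi_regular_def carrier_quot)
  then have bg: "b + g \<approx> word_mult b g"
    using g(1) by (simp add: add_quot mult_quot coset_eq_iff)
  \<comment> \<open>The normal form of \<open>b\<close> times \<open>t\<close>. Every word of
    \<open>m\<close> starts at \<open>t\<close>, so \<open>b\<close> acts on \<open>m\<close> as
    this product does, hence as \<open>B\<close>.\<close>
  define B where "B = b \<star> wd [Vertex t]"
  have B_span: "B \<in> normal_span" unfolding B_def by (rule apply_normal_span[OF t_span b(1)])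
  have B_last: "p \<noteq> [] \<and> last p = Vertex t" if "p \<in> Poly_Mapping.keys B" for p
    using last_keys_apply[OF t_span b(1) _ that[unfolded B_def]] that B_span normal_not_Nil
    by (auto simp: normal_span_def)
  have "B + m = b \<star> m"
    using cong_apply[OF bg t_span] by (simp add: B_def m_def apply_add apply_mult)
  also have "b \<star> m = word_mult b (wd [Vertex t]) \<star> m"
  proof -
    have "lin (act1 (Vertex t)) m = lin (\<lambda>q. wd q) m"
      using m_nf by (intro lin_cong) (auto simp: act1_def t_def)
    then show ?thesis by (simp add: apply_mult apply_wd)
  qed
  also have "\<dots> = B \<star> m"
    using cong_apply[OF cong_normal_form[OF b(1) t] m_span] by (simp add: B_def)
  also have "\<dots> = lin (\<lambda>p. lin (\<lambda>q. wd (butlast p @ q)) m) B"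
    unfolding apply_poly_def
  proof (rule lin_cong)
    fix p
    assume p: "p \<in> Poly_Mapping.keys B"
    have "act p m = lin (\<lambda>q. act p (wd q)) m" by (rule act_eq_lin)
    also have "\<dots> = lin (\<lambda>q. wd (butlast p @ q)) m"
    proof (rule lin_cong)
      fix q
      assume q: "q \<in> Poly_Mapping.keys m"
      \<comment> \<open>Here the choice of \<open>\<gamma>\<close> enters: a letter is forbidden in
        front of a ghost only if it is an edge of the same arc and that arc is special.\<close>
      have "\<not> forbidden z (Ghost \<gamma> 2)" for z using \<gamma> by (cases z) auto
      then have "\<not> forbidden z (hd q)" for z using m_nf[OF q] by simp
      moreover have "normal p" using p B_span by (auto simp: normal_span_def)
      ultimately show "act p (wd q) = (wd (butlast p @ q) :: _ \<Rightarrow>\<^sub>0 'r)"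
        using B_last[OF p] m_nf[OF q] by (intro conjunct1[OF act_concat[of p t q]]) (auto simp: t_def)
    qed
    finally show "act p m = lin (\<lambda>q. wd (butlast p @ q)) m" .
  qed
  \<comment> \<open>Quasi-regularity has become an equation of normal forms whose product is mere
    concatenation, which leaves only \<open>m = 0\<close>.\<close>
  finally have "m = 0"
    using concat_equation_trivial[of B "Vertex t" m] B_last m_nf by blast
  then show False using \<open>m \<noteq> 0\<close> by contradiction
qed

end

theorem theorem50:
  fixes E :: "('v, 'e) pre_digraph" and \<omega> :: "'e \<Rightarrow> nat"
  assumes "lv_graph E \<omega>"
  shows "jacobson_radical (weighted_leavitt_path_algebra E \<omega>
           :: (('v, 'e) letter list \<Rightarrow>\<^sub>0 'r::ring_1_no_zero_divisors) set ring)
         = {\<zero>\<^bsub>weighted_leavitt_path_algebra E \<omega>\<^esub>}"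
proof -
  interpret lv_graph E \<omega> by (rule assms)
  obtain sp where "special_arcs E \<omega> sp" using special_arcs_exist by blast
  then interpret special_arcs E \<omega> sp .
  define I :: "(('v, 'e) letter list \<Rightarrow>\<^sub>0 'r) set"
    where "I = generated_ideal (generators E \<omega>) (wlpa_relations E \<omega>)"
  interpret words_ideal "generators E \<omega>" I
    unfolding I_def by (rule words_ideal_generated_ideal[OF relations_subset_words])
  interpret lv_wlpa E \<omega> sp I
    by unfold_locales (rule I_def)
  show ?thesis
    unfolding weighted_leavitt_path_algebra_def I_def[symmetric]
    by (rule jacobson_radical_quot_eq_zeroI) (rule quasi_regular_ideal_trivial)
qed

end
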